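(* Let $a\colon\mathbb{R}_+\to\mathbb{R}$ be a Hardy field function such that $t^d\log t\prec a(t)\prec t^{d+1}$ or $a(t)\sim t^d\log t$ for some $d\in\mathbb{Z}_+$. Let $b$ be either the sequence $b\colon\mathbb{N}\to\mathbb{T}$, $b(n):=a(n)\bmod 1$, or the sequence $b\colon\mathbb{N}\to\mathbb{S}^1$, $b(n):=e(a(n))$. Then all Furstenberg systems of the sequence $b$ are disjoint from all ergodic measure preserving systems.
   Context: Notation: $\mathbb{N}$ is the set of positive integers, $\mathbb{Z}_+$ the non-negative integers, $\mathbb{T}=\mathbb{R}/\mathbb{Z}$, $\mathbb{S}^1$ the complex unit circle, $e(t):=e^{2\pi i t}$, $[M]:=\{1,\dots,M\}$. For functions on $\mathbb{R}_+$: $a(t)\prec b(t)$ means $\lim_{t\to+\infty}a(t)/b(t)=0$; $a(t)\sim b(t)$ means $\lim_{t\to+\infty}a(t)/b(t)$ exists (in $\mathbb{R}$) and is non-zero. Hardy fields: let $B$ be the ring of germs at $+\infty$ of real valued functions defined on half lines $[c,+\infty)$. A Hardy field is a subfield of $B$ closed under differentiation. All Hardy fields are assumed translation invariant: if $a(t)$ belongs to the field, so does $a(t+h)$ for every $h\in\mathbb{R}$. A Hardy field function is a function whose germ belongs to some Hardy field. Measure preserving systems are $(X,\mu,T)$ with $X$ a compact metric space with its Borel $\sigma$-algebra, $\mu$ a Borel probability measure, and $T$ an invertible measurable measure preserving transformation. Two systems are disjoint if their only joining (measure on the product space invariant under the product transformation and with marginals the two given measures) is the product measure. Furstenberg systems: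 let $Y$ be a compact metric space and $b\colon\mathbb{N}\to Y$ a sequence, extended to $\mathbb{Z}$ arbitrarily (the extension does not matter). Let $X:=Y^{\mathbb{Z}}$ and let $T$ be the shift, $(Tx)(n):=x(n+1)$. If $M_k\to\infty$ is a strictly increasing sequence of positive integers such that the weak-star limit $\mu:=\lim_{k\to\infty}\frac1{M_k}\sum_{m=1}^{M_k}\delta_{T^m b}$ exists, then $(X,\mu,T)$ is called the Furstenberg system of $b$ on $([M_k])_{k\in\mathbb{N}}$, and any system arising in this way is a Furstenberg system of $b$. *)

theory Defs
  imports "HOL-Probability.Probability"
begin

section \<open>Germs at infinity and Hardy fields\<close>

text \<open>Every germ of a function on a half line is represented by a total function.\<close>

quotient_type germ =
  "real \<Rightarrow> real" / "\<lambda>f g. \<forall>\<^sub>F t in at_top. f t = g t"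
  morphisms rep_germ germ_of
proof (rule equivpI)
  show "reflp (\<lambda>f g :: real \<Rightarrow> real. \<forall>\<^sub>F t in at_top. f t = g t)"
    by (simp add: reflp_def)
  show "symp (\<lambda>f g :: real \<Rightarrow> real. \<forall>\<^sub>F t in at_top. f t = g t)"
    by (simp add: symp_def eq_commute)
  show "transp (\<lambda>f g :: real \<Rightarrow> real. \<forall>\<^sub>F t in at_top. f t = g t)"
    by (rule transpI, erule (1) eventually_elim2) simp
qed

instantiation germ :: comm_ring_1
begin

lift_definition zero_germ :: germ is "\<lambda>_. 0" .

lift_definition one_germ :: germ is "\<lambda>_. 1" .

lift_definition plus_germ :: "germ \<Rightarrow> germ \<Rightarrow> germ" is "\<lambda>f g t. f t + g t"
  by (erule (1) eventually_elim2) simp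

lift_definition minus_germ :: "germ \<Rightarrow> germ \<Rightarrow> germ" is "\<lambda>f g t. f t - g t"
  by (erule (1) eventually_elim2) simp

lift_definition uminus_germ :: "germ \<Rightarrow> germ" is "\<lambda>f t. - f t"
  by (elim eventually_mono) simp

lift_definition times_germ :: "germ \<Rightarrow> germ \<Rightarrow> germ" is "\<lambda>f g t. f t * g t"
  by (erule (1) eventually_elim2) simp

instance
  by standard (transfer; simp add: algebra_simps)+

end

definition subfield_of_germs :: "germ set \<Rightarrow> bool" where
  "subfield_of_germs H \<longleftrightarrow>
     0 \<in> H \<and> 1 \<in> H \<and>
     (\<forall>x\<in>H. \<forall>y\<in>H. x + y \<in> H) \<and>
     (\<forall>x\<in>H. - x \<in> H) \<and>
     (\<forall>x\<in>H. \<forall>y\<in>H. x * y \<in> H) \<and>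
     (\<forall>x\<in>H. x \<noteq> 0 \<longrightarrow> (\<exists>y\<in>H. x * y = 1))"

definition hardy_field :: "germ set \<Rightarrow> bool" where
  "hardy_field H \<longleftrightarrow>
     subfield_of_germs H \<and>
     (\<forall>f. germ_of f \<in> H \<longrightarrow>
        (\<exists>g. germ_of g \<in> H \<and> (\<forall>\<^sub>F t in at_top. (f has_real_derivative g t) (at t)))) \<and>
     (\<forall>f h. germ_of f \<in> H \<longrightarrow> germ_of (\<lambda>t. f (t + h)) \<in> H)"

definition hardy_field_function :: "(real \<Rightarrow> real) \<Rightarrow> bool" where
  "hardy_field_function a \<longleftrightarrow> (\<exists>H. hardy_field H \<and> germ_of a \<in> H)"

text \<open>
  Since \<open>x / 0 = 0\<close>, the quotient has to be required to be defined for large arguments;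
  otherwise every function would be negligible with respect to the zero function. For
  \<open>growth_equiv\<close> this is implied by the non-zero limit.
\<close>

definition growth_less :: "(real \<Rightarrow> real) \<Rightarrow> (real \<Rightarrow> real) \<Rightarrow> bool" where
  "growth_less a b \<longleftrightarrow>
     (\<forall>\<^sub>F t in at_top. b t \<noteq> 0) \<and> ((\<lambda>t. a t / b t) \<longlongrightarrow> 0) at_top"

definition growth_equiv :: "(real \<Rightarrow> real) \<Rightarrow> (real \<Rightarrow> real) \<Rightarrow> bool" where
  "growth_equiv a b \<longleftrightarrow> (\<exists>c. c \<noteq> 0 \<and> ((\<lambda>t. a t / b t) \<longlongrightarrow> c) at_top)"


section \<open>Compact metric spaces\<close>

class compact_metric_space = metric_space +
  assumes compact_UNIV_metric: "compact (UNIV :: 'a set)"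

text \<open>The metric of the function space induces the product topology.\<close>

instance "fun" :: (countable, compact_metric_space) compact_metric_space
proof
  have "compact_space (euclidean :: 'b topology)"
    by (simp add: compact_space_def compact_UNIV_metric)
  then have "compact_space (product_topology (\<lambda>_::'a. euclidean :: 'b topology) UNIV)"
    by (simp add: compact_space_product_topology)
  then show "compact (UNIV :: ('a \<Rightarrow> 'b) set)"
    by (simp add: euclidean_product_topology compact_space_def)
qed

subsection \<open>The circle as a quotient of the reals by the integers\<close>

quotient_type torus = real / "\<lambda>x y :: real. x - y \<in> \<int>"
proof (rule equivpI)
  show "reflp (\<lambda>x y :: real. x - y \<in> \<int>)"
    by (simp add: reflp_def)
  show "symp (\<lambda>x y :: real. x - y \<in> \<int>)"
    by (metis (no_types, lifting) Ints_minus minus_diff_eq sympI)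
  show "transp (\<lambda>x y :: real. x - y \<in> \<int>)"
  proof (rule transpI)
    fix x y z :: real
    assume "x - y \<in> \<int>" "y - z \<in> \<int>"
    from Ints_add[OF this] show "x - z \<in> \<int>" by simp
  qed
qed

lift_definition mod_one :: "real \<Rightarrow> torus" is "\<lambda>x. x" .

lemma infdist_Ints_le:
  fixes x :: real
  assumes "k \<in> \<int>"
  shows "infdist x \<int> \<le> \<bar>x - k\<bar>"
  using infdist_le[OF assms, of x] by (simp add: dist_real_def)

lemma infdist_Ints_attained:
  fixes x :: real
  obtains k where "k \<in> \<int>" "infdist x \<int> = \<bar>x - k\<bar>"
  using infdist_attains_inf[of "\<int> :: real set" x, OF closed_Ints] Ints_0
  by (metis dist_real_def empty_iff)

lemma infdist_Ints_shift_le: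
  fixes x y :: real
  assumes "x - y \<in> \<int>"
  shows "infdist x \<int> \<le> infdist y \<int>"
proof -
  obtain k where k: "k \<in> \<int>" "infdist y \<int> = \<bar>y - k\<bar>"
    by (rule infdist_Ints_attained)
  have "infdist x \<int> \<le> \<bar>x - (k + (x - y))\<bar>"
    using assms k(1) by (intro infdist_Ints_le Ints_add)
  with k(2) show ?thesis by simp
qed

lemma infdist_Ints_shift:
  fixes x y :: real
  assumes "x - y \<in> \<int>"
  shows "infdist x \<int> = infdist y \<int>"
  using assms infdist_Ints_shift_le[of x y] infdist_Ints_shift_le[of y x]
    Ints_minus[of "x - y"] by simp

instantiation torus :: metric_space
begin

lift_definition dist_torus :: "torus \<Rightarrow> torus \<Rightarrow> real" is "\<lambda>x y. infdist (x - y) \<int>"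
proof -
  fix x x' y y' :: real
  assume "x - x' \<in> \<int>" "y - y' \<in> \<int>"
  from Ints_diff[OF this] have "(x - y) - (x' - y') \<in> \<int>"
    by (simp add: algebra_simps)
  then show "infdist (x - y) \<int> = infdist (x' - y') \<int>"
    by (rule infdist_Ints_shift)
qed

definition uniformity_torus :: "(torus \<times> torus) filter" where
  "uniformity_torus = (INF e\<in>{0<..}. principal {(x, y). dist x y < e})"

definition open_torus :: "torus set \<Rightarrow> bool" where
  "open_torus U \<longleftrightarrow> (\<forall>x\<in>U. \<forall>\<^sub>F (x', y) in uniformity. x' = x \<longrightarrow> y \<in> U)"

instance
proof
  fix x y z :: torus
  show "dist x y = 0 \<longleftrightarrow> x = y"
    by transfer (metis Ints_0 closed_Ints empty_iff in_closed_iff_infdist_zero)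
  show "dist x y \<le> dist x z + dist y z"
  proof transfer
    fix x y z :: real
    obtain k where k: "k \<in> \<int>" "infdist (x - z) \<int> = \<bar>x - z - k\<bar>"
      by (rule infdist_Ints_attained)
    obtain l where l: "l \<in> \<int>" "infdist (y - z) \<int> = \<bar>y - z - l\<bar>"
      by (rule infdist_Ints_attained)
    have "infdist (x - y) \<int> \<le> \<bar>x - y - (k - l)\<bar>"
      using k(1) l(1) by (intro infdist_Ints_le Ints_diff)
    with k(2) l(2) show "infdist (x - y) \<int> \<le> infdist (x - z) \<int> + infdist (y - z) \<int>"
      by linarith
  qed
qed (simp_all add: uniformity_torus_def open_torus_def)

end

lemma dist_mod_one_le: "dist (mod_one x) (mod_one y) \<le> dist x y"
  by transfer (use infdist_Ints_le[of 0] in \<open>simp add: dist_real_def\<close>)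

lemma continuous_on_mod_one: "continuous_on S mod_one"
  unfolding continuous_on_iff by (meson dist_mod_one_le le_less_trans)

lemma mod_one_image_unit_interval: "mod_one ` {0..1} = UNIV"
proof -
  have "\<exists>t\<in>{0..1}. x = mod_one t" for x
  proof transfer
    fix x :: real
    have "x - frac x \<in> \<int>" by (simp add: frac_def)
    moreover have "frac x \<in> {0..1}" using frac_lt_1[of x] by simp
    ultimately show "\<exists>t\<in>{0..1}. x - t \<in> \<int>" by blast
  qed
  then show ?thesis by blast
qed

instance torus :: compact_metric_space
  by standard
    (metis compact_Icc compact_continuous_image continuous_on_mod_one mod_one_image_unit_interval)

subsection \<open>The complex unit circle\<close>

typedef unit_circle = "sphere (0::complex) 1"
  morphisms complex_of_circle Abs_unit_circle
  by (rule exI[of _ 1]) simp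

setup_lifting type_definition_unit_circle

lift_definition e_circle :: "real \<Rightarrow> unit_circle" is 
  "\<lambda>t. exp (2 * complex_of_real pi * \<i> * complex_of_real t)"
  by (simp add: norm_exp_eq_Re)

instantiation unit_circle :: metric_space
begin

lift_definition dist_unit_circle :: "unit_circle \<Rightarrow> unit_circle \<Rightarrow> real" is dist .

definition uniformity_unit_circle :: "(unit_circle \<times> unit_circle) filter" where
  "uniformity_unit_circle = (INF e\<in>{0<..}. principal {(x, y). dist x y < e})"

definition open_unit_circle :: "unit_circle set \<Rightarrow> bool" where
  "open_unit_circle U \<longleftrightarrow> (\<forall>x\<in>U. \<forall>\<^sub>F (x', y) in uniformity. x' = x \<longrightarrow> y \<in> U)"

instance
proof
  fix x y z :: unit_circle
  show "dist x y = 0 \<longleftrightarrow> x = y"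
    by transfer simp
  show "dist x y \<le> dist x z + dist y z"
    by transfer (rule dist_triangle2)
qed (simp_all add: uniformity_unit_circle_def open_unit_circle_def)

end

instance unit_circle :: compact_metric_space
proof
  have "continuous_on (sphere 0 1) Abs_unit_circle"
    unfolding continuous_on_iff dist_unit_circle.rep_eq
    by (auto simp: Abs_unit_circle_inverse)
  then have "compact (Abs_unit_circle ` sphere 0 1)"
    by (intro compact_continuous_image) auto
  moreover have "Abs_unit_circle ` sphere 0 1 = UNIV"
    using type_definition.Abs_image[OF type_definition_unit_circle] .
  ultimately show "compact (UNIV :: unit_circle set)" by simp
qed


section \<open>Measure preserving systems\<close>

definition measure_preserving_system ::
    "'x::compact_metric_space measure \<Rightarrow> ('x \<Rightarrow> 'x) \<Rightarrow> bool" where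
  "measure_preserving_system M T \<longleftrightarrow>
     sets M = sets borel \<and> prob_space M \<and>
     T \<in> M \<rightarrow>\<^sub>M M \<and> bij T \<and> inv T \<in> M \<rightarrow>\<^sub>M M \<and>
     distr M M T = M"

definition ergodic_system ::
    "'x::compact_metric_space measure \<Rightarrow> ('x \<Rightarrow> 'x) \<Rightarrow> bool" where
  "ergodic_system M T \<longleftrightarrow>
     measure_preserving_system M T \<and>
     (\<forall>A\<in>sets M. T -` A = A \<longrightarrow> measure M A = 0 \<or> measure M A = 1)"

definition joining ::
    "'x measure \<Rightarrow> ('x \<Rightarrow> 'x) \<Rightarrow> 'y measure \<Rightarrow> ('y \<Rightarrow> 'y) \<Rightarrow> ('x \<times> 'y) measure \<Rightarrow> bool" where
  "joining M T N S J \<longleftrightarrow>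
     sets J = sets (M \<Otimes>\<^sub>M N) \<and>
     distr J J (map_prod T S) = J \<and>
     distr J M fst = M \<and> distr J N snd = N"

definition disjoint_systems ::
    "'x measure \<Rightarrow> ('x \<Rightarrow> 'x) \<Rightarrow> 'y measure \<Rightarrow> ('y \<Rightarrow> 'y) \<Rightarrow> bool" where
  "disjoint_systems M T N S \<longleftrightarrow> (\<forall>J. joining M T N S J \<longrightarrow> J = M \<Otimes>\<^sub>M N)"


section \<open>Furstenberg systems\<close>

definition left_shift :: "(int \<Rightarrow> 'y) \<Rightarrow> (int \<Rightarrow> 'y)" where
  "left_shift x = (\<lambda>n. x (n + 1))"

text \<open>
  Weak-star convergence of the averages of the point masses at the points \<open>(left_shift ^^ m) x\<close>,
  \<open>1 \<le> m \<le> K k\<close>, tested against the continuous functions on the (compact) space.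
\<close>

definition furstenberg_system_on ::
    "(int \<Rightarrow> 'y::compact_metric_space) \<Rightarrow> (nat \<Rightarrow> nat) \<Rightarrow> (int \<Rightarrow> 'y) measure \<Rightarrow> bool" where
  "furstenberg_system_on x K M \<longleftrightarrow>
     strict_mono K \<and> (\<forall>k. K k > 0) \<and>
     sets M = sets borel \<and> prob_space M \<and>
     (\<forall>f :: (int \<Rightarrow> 'y) \<Rightarrow> real. continuous_on UNIV f \<longrightarrow>
        (\<lambda>k. (\<Sum>m=1..K k. f ((left_shift ^^ m) x)) / real (K k)) \<longlonglongrightarrow> integral\<^sup>L M f)"

text \<open>
  The system is \<open>(M, left_shift)\<close>. Only the values of \<open>b\<close> at positive integers enter; the
  extension to the integers is arbitrary.
\<close>

definition furstenberg_system ::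
    "(nat \<Rightarrow> 'y::compact_metric_space) \<Rightarrow> (int \<Rightarrow> 'y) measure \<Rightarrow> bool" where
  "furstenberg_system b M \<longleftrightarrow>
     (\<exists>x K. (\<forall>n\<ge>1. x (int n) = b n) \<and> furstenberg_system_on x K M)"

end

theory Submission
  imports Defs
begin

text \<open>
  Let \<open>\<Delta>\<close> be the difference operator and \<open>g = \<Delta>\<^bsup>d+1\<^esup> a\<close>. In the Hardy field, \<open>g\<close> is eventually
  monotone with limit \<open>0\<close>, and \<open>t \<bar>g(t)\<bar>\<close> stays away from \<open>0\<close>. Hence in a Furstenberg
  system \<open>(X, \<mu>, T)\<close> almost every point is a polynomial sequence of degree at most \<open>d\<close> modulo \<open>1\<close>,
  so that every character of \<open>X\<close> is a monomial in the multiplicative differences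
  \<open>D\<^sub>0, \<dots>, D\<^sub>d\<close>, where \<open>D\<^sub>i \<circ> T = D\<^sub>i D\<^sub>i\<^sub>+\<^sub>1\<close> and \<open>D\<^sub>d\<close> is invariant. Moreover the Fourier
  coefficients of the distribution of \<open>D\<^sub>d\<close> are \<open>O(1/h)\<close>, by the Kusmin-Landau inequality.

  Let \<open>J\<close> be a joining with an ergodic system. An invariant function on \<open>X\<close> is independent of the
  ergodic factor. For a monomial whose first factor is \<open>D\<^sub>k\<close> with \<open>k < d\<close>, van der Corput's trick
  replaces the monomial \<open>F\<close> by \<open>F \<circ> T\<^sup>h\<close> times the conjugate of \<open>F\<close>, a monomial whose
  first factor is \<open>D\<^sub>k\<^sub>+\<^sub>1\<close>. After finitely many steps only a power of \<open>D\<^sub>d\<close> is left, and the decay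
  of the Fourier coefficients shows that the monomial is uncorrelated with the ergodic factor. By
  the Stone-Weierstrass theorem \<open>J\<close> is the product measure.
\<close>

section \<open>Differences of Hardy field functions\<close>

text \<open>Differences, not derivatives, are what the shift map sees of a sequence; they stay
  inside a Hardy field because of translation invariance.\<close>

definition fdiff :: "(real \<Rightarrow> real) \<Rightarrow> real \<Rightarrow> real" where
  "fdiff f t = f (t + 1) - f t"

section \<open>Closure properties of Hardy fields and signs of their germs\<close>

lemma germ_of_eq_iff: "germ_of f = germ_of g \<longleftrightarrow> (\<forall>\<^sub>F t in at_top. f t = g t)"
  by (simp add: germ.abs_eq_iff)

lemma zero_germ_eq: "0 = germ_of (\<lambda>_. 0)"
  by (simp add: zero_germ.abs_eq)

context
  fixes H :: "germ set"
  assumes H: "hardy_field H"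
begin

lemma hardy_field_add:
  assumes "germ_of f \<in> H" "germ_of g \<in> H"
  shows "germ_of (\<lambda>t. f t + g t) \<in> H"
proof -
  have "germ_of f + germ_of g \<in> H"
    using H assms by (simp add: hardy_field_def subfield_of_germs_def)
  then show ?thesis by (simp add: plus_germ.abs_eq)
qed

lemma hardy_field_mult:
  assumes "germ_of f \<in> H" "germ_of g \<in> H"
  shows "germ_of (\<lambda>t. f t * g t) \<in> H"
proof -
  have "germ_of f * germ_of g \<in> H"
    using H assms by (simp add: hardy_field_def subfield_of_germs_def)
  then show ?thesis by (simp add: times_germ.abs_eq)
qed

lemma hardy_field_one: "germ_of (\<lambda>_. 1) \<in> H"
  using H by (simp add: hardy_field_def subfield_of_germs_def one_germ.abs_eq[symmetric])

lemma hardy_field_uminus: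
  assumes "germ_of f \<in> H"
  shows "germ_of (\<lambda>t. - f t) \<in> H"
proof -
  have "- germ_of f \<in> H"
    using H assms by (simp add: hardy_field_def subfield_of_germs_def)
  then show ?thesis by (simp add: uminus_germ.abs_eq)
qed

lemma hardy_field_fdiff:
  assumes "germ_of f \<in> H"
  shows "germ_of (fdiff f) \<in> H"
proof -
  have "germ_of (\<lambda>t. f (t + 1)) \<in> H"
    using H assms unfolding hardy_field_def by blast
  from hardy_field_add[OF this hardy_field_uminus[OF assms]]
  show ?thesis by (simp add: fdiff_def[abs_def])
qed

lemma hardy_field_funpow_fdiff:
  assumes "germ_of f \<in> H"
  shows "germ_of ((fdiff ^^ k) f) \<in> H"
  by (induction k) (use assms hardy_field_fdiff in auto)

lemma hardy_field_deriv:
  assumes "germ_of f \<in> H"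
  obtains g where "germ_of g \<in> H" "\<forall>\<^sub>F t in at_top. (f has_real_derivative g t) (at t)"
  using H assms unfolding hardy_field_def by blast

lemma hardy_field_inverse:
  assumes "germ_of f \<in> H" "\<not> (\<forall>\<^sub>F t in at_top. f t = 0)"
  obtains g where "germ_of g \<in> H" "\<forall>\<^sub>F t in at_top. f t * g t = 1"
proof -
  have "germ_of f \<noteq> 0"
    using assms(2) by (simp add: zero_germ_eq germ_of_eq_iff)
  moreover have "\<forall>x\<in>H. x \<noteq> 0 \<longrightarrow> (\<exists>y\<in>H. x * y = 1)"
    using H by (simp add: hardy_field_def subfield_of_germs_def)
  ultimately obtain y where y: "y \<in> H" "germ_of f * y = 1"
    using assms(1) by blast
  obtain g where "y = germ_of g"
    using Quotient_abs_rep[OF Quotient_germ] by metis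
  with y that show thesis
    by (simp add: times_germ.abs_eq one_germ.abs_eq germ.abs_eq_iff)
qed

text \<open>A non-zero germ has an inverse in the field, so the function eventually has no zeros;
  being eventually differentiable it is also eventually continuous, and the intermediate value
  theorem fixes its sign.\<close>

lemma hardy_field_eventually_sign:
  assumes "germ_of f \<in> H"
  shows "(\<forall>\<^sub>F t in at_top. f t \<ge> 0) \<or> (\<forall>\<^sub>F t in at_top. f t \<le> 0)"
proof (cases "\<forall>\<^sub>F t in at_top. f t = 0")
  case True
  then have "\<forall>\<^sub>F t in at_top. f t \<ge> 0" by eventually_elim simp
  then show ?thesis ..
next
  case False
  with assms obtain g where g: "\<forall>\<^sub>F t in at_top. f t * g t = 1"
    by (blast elim: hardy_field_inverse)
  obtain f' where "\<forall>\<^sub>F t in at_top. (f has_real_derivative f' t) (at t)"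
    using assms by (rule hardy_field_deriv)
  with g have "\<forall>\<^sub>F t in at_top. f t \<noteq> 0 \<and> isCont f t"
    by eventually_elim (auto dest: DERIV_isCont)
  then obtain c where c: "\<And>t. t \<ge> c \<Longrightarrow> f t \<noteq> 0 \<and> isCont f t"
    by (auto simp: eventually_at_top_linorder)
  then have "connected (f ` {c..})"
    by (intro connected_continuous_image continuous_at_imp_continuous_on) auto
  moreover have "0 \<notin> f ` {c..}" using c by auto
  ultimately have "(\<forall>t\<ge>c. f t \<ge> 0) \<or> (\<forall>t\<ge>c. f t \<le> 0)"
    unfolding connected_iff_interval by (meson atLeast_iff image_eqI linear)
  then show ?thesis by (auto simp: eventually_at_top_linorder)
qed

end

section \<open>Eventually monotone functions and their behaviour at infinity\<close>

definition mono_near_top :: "(real \<Rightarrow> real) \<Rightarrow> bool" where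
  "mono_near_top f \<longleftrightarrow> (\<exists>c. mono_on {c..} f)"

lemma mono_near_topI:
  assumes "\<forall>\<^sub>F t in at_top. (f has_real_derivative f' t) (at t)"
    and "\<forall>\<^sub>F t in at_top. f' t \<ge> 0"
  shows "mono_near_top f"
proof -
  obtain c where c: "\<And>t. t \<ge> c \<Longrightarrow> (f has_real_derivative f' t) (at t) \<and> f' t \<ge> 0"
    using eventually_conj[OF assms] by (auto simp: eventually_at_top_linorder)
  have "mono_on {c..} f"
  proof (rule mono_onI)
    fix s t assume "s \<in> {c..}" "t \<in> {c..}" "s \<le> t"
    then have "\<exists>y. (f has_real_derivative y) (at x) \<and> y \<ge> 0" if "s \<le> x" "x \<le> t" for x
      using c[of x] that by auto
    with \<open>s \<le> t\<close> show "f s \<le> f t" by (rule DERIV_nonneg_imp_nondecreasing)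
  qed
  then show ?thesis unfolding mono_near_top_def ..
qed

lemma mono_near_top_cases:
  assumes "\<forall>\<^sub>F t in at_top. (f has_real_derivative f' t) (at t)"
    and "(\<forall>\<^sub>F t in at_top. f' t \<ge> 0) \<or> (\<forall>\<^sub>F t in at_top. f' t \<le> 0)"
  shows "mono_near_top f \<or> mono_near_top (\<lambda>t. - f t)"
  using assms(2)
proof
  assume "\<forall>\<^sub>F t in at_top. f' t \<le> 0"
  then have "\<forall>\<^sub>F t in at_top. - f' t \<ge> 0" by simp
  moreover have "\<forall>\<^sub>F t in at_top. ((\<lambda>t. - f t) has_real_derivative - f' t) (at t)"
    using assms(1) by eventually_elim (rule DERIV_minus)
  ultimately have "mono_near_top (\<lambda>t. - f t)" by (intro mono_near_topI)
  then show ?thesis ..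
qed (use assms(1) mono_near_topI in blast)

lemma mono_near_top_sign:
  assumes "mono_near_top f"
  shows "(\<forall>\<^sub>F t in at_top. f t \<ge> 0) \<or> (\<forall>\<^sub>F t in at_top. f t \<le> 0)"
proof -
  obtain c where c: "mono_on {c..} f" using assms unfolding mono_near_top_def ..
  show ?thesis
  proof (cases "\<exists>s\<ge>c. f s \<ge> 0")
    case True
    then obtain s where "s \<ge> c" "f s \<ge> 0" by blast
    then have "\<forall>t\<ge>s. f t \<ge> 0" using c unfolding mono_on_def
      by (meson atLeast_iff order_trans)
    then show ?thesis by (auto simp: eventually_at_top_linorder)
  next
    case False
    then have "\<forall>t\<ge>c. f t \<le> 0" by (meson linear)
    then show ?thesis by (auto simp: eventually_at_top_linorder)
  qed
qed

text \<open>A positive value beyond \<open>c\<close> is itself a lower bound from then on. If there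
  is none, \<open>f\<close> increases with values at most 0, so a single value above
  \<open>- \<epsilon>\<close> would trap it between \<open>- \<epsilon>\<close> and 0 for good; not
  tending to 0 forbids this for some \<open>\<epsilon>\<close>.\<close>

lemma mono_near_top_tendsto_0_or:
  assumes "mono_near_top f" "\<not> (f \<longlongrightarrow> 0) at_top"
  obtains \<epsilon> where "\<epsilon> > 0" "(\<forall>\<^sub>F t in at_top. f t \<ge> \<epsilon>) \<or> (\<forall>\<^sub>F t in at_top. f t \<le> - \<epsilon>)"
proof -
  obtain c where c: "mono_on {c..} f" using assms unfolding mono_near_top_def by blast
  have up: "\<forall>\<^sub>F t in at_top. f t \<ge> f s" if "s \<ge> c" for s
    using c that unfolding mono_on_def eventually_at_top_linorder
    by (meson atLeast_iff order_trans)
  show thesis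
  proof (cases "\<exists>s\<ge>c. f s > 0")
    case True
    then show thesis using up that by blast
  next
    case False
    then have neg: "\<And>t. t \<ge> c \<Longrightarrow> f t \<le> 0" by (meson not_le)
    from assms(2) obtain \<epsilon> where \<epsilon>: "\<epsilon> > 0" "\<not> (\<forall>\<^sub>F t in at_top. \<bar>f t\<bar> < \<epsilon>)"
      by (auto simp: tendsto_iff dist_real_def)
    have "f s \<le> - \<epsilon>" if s: "s \<ge> c" for s
    proof (rule ccontr)
      assume "\<not> f s \<le> - \<epsilon>"
      have "\<forall>\<^sub>F t in at_top. \<bar>f t\<bar> < \<epsilon>"
        using up[OF s] eventually_ge_at_top[of c]
        by eventually_elim (use neg \<open>\<not> f s \<le> - \<epsilon>\<close> in force)
      with \<epsilon>(2) show False ..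
    qed
    then have "\<forall>\<^sub>F t in at_top. f t \<le> - \<epsilon>" by (auto simp: eventually_at_top_linorder)
    with \<epsilon>(1) that show thesis by blast
  qed
qed

lemma tendsto_0_or_bounded_away:
  assumes "mono_near_top f \<or> mono_near_top (\<lambda>t. - f t)" "\<not> (f \<longlongrightarrow> 0) at_top"
  obtains \<epsilon> where "\<epsilon> > 0" "(\<forall>\<^sub>F t in at_top. f t \<ge> \<epsilon>) \<or> (\<forall>\<^sub>F t in at_top. - f t \<ge> \<epsilon>)"
  using assms(1)
proof
  assume "mono_near_top f"
  then obtain \<epsilon> where "\<epsilon> > 0" "(\<forall>\<^sub>F t in at_top. f t \<ge> \<epsilon>) \<or> (\<forall>\<^sub>F t in at_top. f t \<le> - \<epsilon>)"
    using assms(2) by (rule mono_near_top_tendsto_0_or)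
  then show thesis using that by (simp add: le_minus_iff)
next
  assume *: "mono_near_top (\<lambda>t. - f t)"
  have "\<not> ((\<lambda>t. - f t) \<longlongrightarrow> 0) at_top"
    using assms(2) by (simp add: tendsto_minus_cancel_left[symmetric])
  with * obtain \<epsilon> where
    "\<epsilon> > 0" "(\<forall>\<^sub>F t in at_top. - f t \<ge> \<epsilon>) \<or> (\<forall>\<^sub>F t in at_top. - f t \<le> - \<epsilon>)"
    by (rule mono_near_top_tendsto_0_or)
  then show thesis using that by auto
qed

text \<open>The derivative lies in the field and so has an eventual sign.\<close>

lemma hardy_field_mono_near_top:
  assumes "hardy_field H" "germ_of f \<in> H"
  shows "mono_near_top f \<or> mono_near_top (\<lambda>t. - f t)"
proof -
  obtain f' where "germ_of f' \<in> H" "\<forall>\<^sub>F t in at_top. (f has_real_derivative f' t) (at t)"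
    using assms by (rule hardy_field_deriv)
  then show ?thesis
    using hardy_field_eventually_sign[OF assms(1)] by (intro mono_near_top_cases)
qed

text \<open>The field need not contain the identity; but \<open>t + f / f'\<close> is monotone because
  its derivative lies in the field, and this determines the sign of \<open>(t f)'\<close>.\<close>

lemma hardy_field_ident_mult_mono_near_top:
  assumes H: "hardy_field H" and f: "germ_of f \<in> H"
  shows "mono_near_top (\<lambda>t. t * f t) \<or> mono_near_top (\<lambda>t. - (t * f t))"
proof -
  obtain f' where f': "germ_of f' \<in> H" "\<forall>\<^sub>F t in at_top. (f has_real_derivative f' t) (at t)"
    using H f by (rule hardy_field_deriv)
  have deriv: "\<forall>\<^sub>F t in at_top. ((\<lambda>t. t * f t) has_real_derivative f t + t * f' t) (at t)"
    using f'(2) by eventually_elim (auto intro!: derivative_eq_intros)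
  have "(\<forall>\<^sub>F t in at_top. f t + t * f' t \<ge> 0) \<or> (\<forall>\<^sub>F t in at_top. f t + t * f' t \<le> 0)"
  \<comment> \<open>The zero germ has no inverse, so \<open>f / f'\<close> is available only when
    \<open>f'\<close> is not eventually 0. In the exceptional case \<open>f t + t * f' t\<close> is
    eventually \<open>f t\<close>, whose sign is known.\<close>
  proof (cases "\<forall>\<^sub>F t in at_top. f' t = 0")
    case True
    have "(\<forall>\<^sub>F t in at_top. f t \<ge> 0) \<or> (\<forall>\<^sub>F t in at_top. f t \<le> 0)"
      using H f by (rule hardy_field_eventually_sign)
    then show ?thesis
    proof
      assume "\<forall>\<^sub>F t in at_top. f t \<ge> 0"
      with True have "\<forall>\<^sub>F t in at_top. f t + t * f' t \<ge> 0" by eventually_elim simp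
      then show ?thesis ..
    next
      assume "\<forall>\<^sub>F t in at_top. f t \<le> 0"
      with True have "\<forall>\<^sub>F t in at_top. f t + t * f' t \<le> 0" by eventually_elim simp
      then show ?thesis ..
    qed
  next
    case False
    then obtain g where g: "germ_of g \<in> H" "\<forall>\<^sub>F t in at_top. f' t * g t = 1"
      using hardy_field_inverse[OF H f'(1)] by blast
    define u where "u = (\<lambda>t. f t * g t)"
    have "germ_of u \<in> H" unfolding u_def by (rule hardy_field_mult[OF H f g(1)])
    then obtain u' where u': "germ_of u' \<in> H" "\<forall>\<^sub>F t in at_top. (u has_real_derivative u' t) (at t)"
      using hardy_field_deriv[OF H] by blast
    have "\<forall>\<^sub>F t in at_top. ((\<lambda>t. t + u t) has_real_derivative 1 + u' t) (at t)"
      using u'(2) by eventually_elim (auto intro!: derivative_eq_intros)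
    moreover have "germ_of (\<lambda>t. 1 + u' t) \<in> H"
      by (rule hardy_field_add[OF H hardy_field_one[OF H] u'(1)])
    ultimately have "mono_near_top (\<lambda>t. t + u t) \<or> mono_near_top (\<lambda>t. - (t + u t))"
      using hardy_field_eventually_sign[OF H] by (intro mono_near_top_cases)
    then have "(\<forall>\<^sub>F t in at_top. t + u t \<ge> 0) \<or> (\<forall>\<^sub>F t in at_top. t + u t \<le> 0)"
      using mono_near_top_sign[of "\<lambda>t. t + u t"] mono_near_top_sign[of "\<lambda>t. - (t + u t)"]
      by (auto simp: neg_0_le_iff_le neg_le_0_iff_le simp del: minus_add_distrib)
    moreover have eq: "\<forall>\<^sub>F t in at_top. f t + t * f' t = f' t * (t + u t)"
      using g(2) by eventually_elim (simp add: u_def algebra_simps)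
    moreover have "(\<forall>\<^sub>F t in at_top. f' t \<ge> 0) \<or> (\<forall>\<^sub>F t in at_top. f' t \<le> 0)"
      using H f'(1) by (rule hardy_field_eventually_sign)
    ultimately show ?thesis
    proof (elim disjE, goal_cases)
      case 1
      then have "\<forall>\<^sub>F t in at_top. f t + t * f' t \<ge> 0" by eventually_elim simp
      then show ?case ..
    next
      case 2
      then have "\<forall>\<^sub>F t in at_top. f t + t * f' t \<le> 0"
        by eventually_elim (simp add: mult_nonpos_nonneg)
      then show ?case ..
    next
      case 3
      then have "\<forall>\<^sub>F t in at_top. f t + t * f' t \<le> 0"
        by eventually_elim (simp add: mult_nonneg_nonpos)
      then show ?case ..
    next
      case 4
      then have "\<forall>\<^sub>F t in at_top. f t + t * f' t \<ge> 0"
        by eventually_elim (simp add: mult_nonpos_nonpos)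
      then show ?case ..
    qed
  qed
  with deriv show ?thesis by (rule mono_near_top_cases)
qed


section \<open>Summation: recovering the growth of a function from its differences\<close>

lemma funpow_fdiff_uminus: "(fdiff ^^ k) (\<lambda>t. - f t) = (\<lambda>t. - (fdiff ^^ k) f t)"
  by (induction k) (auto simp: fdiff_def)

lemma funpow_fdiff_Suc_of_nat:
  "(fdiff ^^ Suc k) f (real n) = (fdiff ^^ k) f (real (Suc n)) - (fdiff ^^ k) f (real n)"
  by (simp add: fdiff_def add.commute)

lemma eventually_increasing_bounded_below:
  fixes w :: "nat \<Rightarrow> real"
  assumes "\<forall>\<^sub>F n in sequentially. w n \<le> w (Suc n)"
  obtains C where "\<forall>\<^sub>F n in sequentially. C \<le> w n"
proof -
  obtain n0 where n0: "\<And>n. n \<ge> n0 \<Longrightarrow> w n \<le> w (Suc n)"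
    using assms by (auto simp: eventually_sequentially)
  have "w n0 \<le> w n" if "n \<ge> n0" for n
    using that by (induction n rule: dec_induct) (auto intro: order_trans n0)
  then have "\<forall>\<^sub>F n in sequentially. w n0 \<le> w n" by (auto simp: eventually_sequentially)
  then show thesis by (rule that)
qed

text \<open>The difference \<open>u - v\<close> eventually increases, hence is bounded below by a
  constant, and half of the divergent \<open>v\<close> swallows that constant.\<close>

lemma eventually_half_le_of_increments:
  fixes u v :: "nat \<Rightarrow> real"
  assumes "\<forall>\<^sub>F n in sequentially. v (Suc n) - v n \<le> u (Suc n) - u n"
    and v: "filterlim v at_top sequentially"
  shows "\<forall>\<^sub>F n in sequentially. v n / 2 \<le> u n"
proof -
  have "\<forall>\<^sub>F n in sequentially. u n - v n \<le> u (Suc n) - v (Suc n)"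
    using assms(1) by eventually_elim simp
  then obtain C where C: "\<forall>\<^sub>F n in sequentially. C \<le> u n - v n"
    by (rule eventually_increasing_bounded_below)
  have "\<forall>\<^sub>F n in sequentially. v n \<ge> - 2 * C"
    using v by (auto simp: filterlim_at_top)
  with C show ?thesis by eventually_elim auto
qed

text \<open>The same reasoning for both \<open>v - u\<close> and \<open>v + u\<close>: a discrete
  comparison of antiderivatives, used for harmonic sums and for Cesaro means.\<close>

lemma eventually_abs_le_of_increments:
  fixes u v :: "nat \<Rightarrow> real"
  assumes "\<forall>\<^sub>F n in sequentially. \<bar>u (Suc n) - u n\<bar> \<le> v (Suc n) - v n"
    and v: "filterlim v at_top sequentially"
  shows "\<forall>\<^sub>F n in sequentially. \<bar>u n\<bar> \<le> 2 * v n"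
proof -
  have "\<forall>\<^sub>F n in sequentially. v n - u n \<le> v (Suc n) - u (Suc n)"
    using assms(1) by eventually_elim (simp add: abs_le_iff)
  then obtain C where C: "\<forall>\<^sub>F n in sequentially. C \<le> v n - u n"
    by (rule eventually_increasing_bounded_below)
  have "\<forall>\<^sub>F n in sequentially. v n + u n \<le> v (Suc n) + u (Suc n)"
    using assms(1) by eventually_elim (simp add: abs_le_iff)
  then obtain C' where C': "\<forall>\<^sub>F n in sequentially. C' \<le> v n + u n"
    by (rule eventually_increasing_bounded_below)
  have "\<forall>\<^sub>F n in sequentially. v n \<ge> - C" "\<forall>\<^sub>F n in sequentially. v n \<ge> - C'"
    using v by (auto simp: filterlim_at_top)
  with C C' show ?thesis by eventually_elim auto
qed

lemma filterlim_binomial_at_top: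
  "filterlim (\<lambda>n. real (n choose Suc j)) at_top sequentially"
proof (rule filterlim_at_top_mono)
  show "filterlim (\<lambda>n. real n / real (Suc j)) at_top sequentially"
    using filterlim_tendsto_pos_mult_at_top[OF tendsto_const[of "1 / real (Suc j)"] _
        filterlim_real_sequentially] by simp
  show "\<forall>\<^sub>F n in sequentially. real n / real (Suc j) \<le> real (n choose Suc j)"
    using eventually_ge_at_top[of "Suc j"]
  proof eventually_elim
    case (elim n)
    have "real n / real (Suc j) \<le> (real n / real (Suc j)) ^ Suc j"
      using elim by (intro self_le_power) auto
    also have "\<dots> \<le> real (n choose Suc j)"
      using binomial_ge_n_over_k_pow_k[OF elim, where 'a = real] by simp
    finally show ?case .
  qed
qed

text \<open>By Pascal's rule \<open>n choose Suc j\<close> is a discrete antiderivative of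
  \<open>n choose j\<close>, so every undone difference raises the binomial by one degree and costs
  a factor 2 in the constant.\<close>

lemma binomial_lower_bound_of_funpow_fdiff:
  assumes "\<forall>\<^sub>F n in sequentially. \<epsilon> * real (n choose j) \<le> (fdiff ^^ k) f (real n)" "\<epsilon> > 0"
  shows "\<exists>\<epsilon>'>0. \<forall>\<^sub>F n in sequentially. \<epsilon>' * real (n choose (j + k)) \<le> f (real n)"
  using assms
proof (induction k arbitrary: j \<epsilon>)
  case 0
  then show ?case by auto
next
  case (Suc k)
  have "filterlim (\<lambda>n. \<epsilon> * real (n choose Suc j)) at_top sequentially"
    using Suc.prems(2) filterlim_binomial_at_top[of j]
    by (intro filterlim_tendsto_pos_mult_at_top[OF tendsto_const])
  moreover have "\<forall>\<^sub>F n in sequentially. \<epsilon> * real (Suc n choose Suc j) - \<epsilon> * real (n choose Suc j)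
      \<le> (fdiff ^^ k) f (real (Suc n)) - (fdiff ^^ k) f (real n)"
    using Suc.prems(1) unfolding funpow_fdiff_Suc_of_nat
    by eventually_elim (simp add: algebra_simps)
  ultimately have "\<forall>\<^sub>F n in sequentially. \<epsilon> * real (n choose Suc j) / 2 \<le> (fdiff ^^ k) f (real n)"
    by (rule eventually_half_le_of_increments[rotated])
  then have "\<forall>\<^sub>F n in sequentially. \<epsilon> / 2 * real (n choose Suc j) \<le> (fdiff ^^ k) f (real n)"
    by (simp add: mult.commute)
  from Suc.IH[OF this] Suc.prems(2) show ?case by simp
qed

text \<open>A difference of order \<open>d + 1\<close> bounded below by a positive constant would
  make \<open>f\<close> grow at least like \<open>n choose Suc d\<close>, which has the order of
  \<open>n ^ Suc d\<close>.\<close>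

lemma growth_less_power_fdiff_not_ge:
  assumes "growth_less f (\<lambda>t. t ^ Suc d)" "\<epsilon> > 0"
  shows "\<not> (\<forall>\<^sub>F t in at_top. \<epsilon> \<le> (fdiff ^^ Suc d) f t)"
proof
  assume "\<forall>\<^sub>F t in at_top. \<epsilon> \<le> (fdiff ^^ Suc d) f t"
  then have "\<forall>\<^sub>F n in sequentially. \<epsilon> * real (n choose 0) \<le> (fdiff ^^ Suc d) f (real n)"
    using filterlim_real_sequentially unfolding filterlim_iff by fastforce
  from binomial_lower_bound_of_funpow_fdiff[OF this assms(2)] obtain \<epsilon>' where
    \<epsilon>': "\<epsilon>' > 0" "\<forall>\<^sub>F n in sequentially. \<epsilon>' * real (n choose Suc d) \<le> f (real n)" by auto
  \<comment> \<open>\<open>n choose k\<close> is at least \<open>(n / k) ^ k\<close>, which yields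
    this constant for \<open>k = Suc d\<close>.\<close>
  define \<delta> where "\<delta> = \<epsilon>' / real (Suc d) ^ Suc d"
  have "\<delta> > 0" using \<epsilon>'(1) by (simp add: \<delta>_def)
  have "((\<lambda>n. f (real n) / real n ^ Suc d) \<longlongrightarrow> 0) sequentially"
    using assms(1) unfolding growth_less_def
    by (intro filterlim_compose[OF _ filterlim_real_sequentially, of "\<lambda>t. f t / t ^ Suc d"]) auto
  then have "\<forall>\<^sub>F n in sequentially. f (real n) / real n ^ Suc d < \<delta>"
    using \<open>\<delta> > 0\<close> by (rule order_tendstoD)
  moreover have "\<forall>\<^sub>F n in sequentially. \<delta> \<le> f (real n) / real n ^ Suc d"
    using \<epsilon>'(2) eventually_ge_at_top[of "Suc d"]
  proof eventually_elim
    case (elim n)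
    have "\<delta> * real n ^ Suc d = \<epsilon>' * (real n / real (Suc d)) ^ Suc d"
      by (simp add: \<delta>_def power_divide)
    also have "\<dots> \<le> \<epsilon>' * real (n choose Suc d)"
      using binomial_ge_n_over_k_pow_k[OF elim(2), where 'a = real] \<epsilon>'(1)
      by (intro mult_left_mono) auto
    also have "\<dots> \<le> f (real n)" by (rule elim(1))
    finally show ?case using elim(2) by (simp add: pos_le_divide_eq)
  qed
  ultimately have "\<forall>\<^sub>F n :: nat in sequentially. False" by eventually_elim simp
  then show False by simp
qed

text \<open>Being monotone near infinity, the difference either tends to 0 or keeps a fixed distance
  from 0 on one side; the latter contradicts the growth of \<open>f\<close> or of
  \<open>- f\<close>.\<close>

lemma funpow_fdiff_tendsto_0:
  assumes "hardy_field H" "germ_of f \<in> H" "growth_less f (\<lambda>t. t ^ Suc d)"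
  shows "((fdiff ^^ Suc d) f \<longlongrightarrow> 0) at_top"
proof (rule ccontr)
  let ?g = "(fdiff ^^ Suc d) f"
  assume "\<not> (?g \<longlongrightarrow> 0) at_top"
  then obtain \<epsilon> where \<epsilon>: "\<epsilon> > 0"
      "(\<forall>\<^sub>F t in at_top. ?g t \<ge> \<epsilon>) \<or> (\<forall>\<^sub>F t in at_top. - ?g t \<ge> \<epsilon>)"
    using hardy_field_mono_near_top[OF assms(1) hardy_field_funpow_fdiff[OF assms(1,2)]]
    by (metis tendsto_0_or_bounded_away)
  have "growth_less (\<lambda>t. - f t) (\<lambda>t. t ^ Suc d)"
    using assms(3) tendsto_minus[of "\<lambda>t. f t / t ^ Suc d" 0] unfolding growth_less_def by simp
  from growth_less_power_fdiff_not_ge[OF this \<epsilon>(1)]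
    growth_less_power_fdiff_not_ge[OF assms(3) \<epsilon>(1)] \<epsilon>(2)
  show False unfolding funpow_fdiff_uminus by blast
qed

lemma filterlim_power_harm_at_top:
  "filterlim (\<lambda>n. real n ^ j * harm n) at_top sequentially"
proof (rule filterlim_at_top_mono)
  show "filterlim (\<lambda>n. harm n :: real) at_top sequentially" by (rule harm_at_top)
  show "\<forall>\<^sub>F n in sequentially. harm n \<le> real n ^ j * harm n"
    using eventually_ge_at_top[of 1]
  proof eventually_elim
    case (elim n)
    then have "1 * harm n \<le> real n ^ j * harm n"
      by (intro mult_right_mono) (auto simp: harm_nonneg)
    then show ?case by simp
  qed
qed

text \<open>Harmonic numbers replace the logarithm, as their increments are explicit. The increment
  of \<open>n ^ Suc j * harm n\<close> is at least \<open>n ^ j * harm n\<close>, so each undone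
  difference raises the power of \<open>n\<close> by one; having the bound for every
  \<open>\<epsilon>\<close> absorbs the factor 2 lost in each comparison.\<close>

lemma funpow_fdiff_small_o_harm:
  assumes "\<And>\<epsilon>. \<epsilon> > 0 \<Longrightarrow>
      \<forall>\<^sub>F n in sequentially. \<bar>(fdiff ^^ k) f (real n)\<bar> \<le> \<epsilon> * (real n ^ j * harm n)"
    and "\<epsilon> > 0"
  shows "\<forall>\<^sub>F n in sequentially. \<bar>f (real n)\<bar> \<le> \<epsilon> * (real n ^ (j + k) * harm n)"
  using assms
proof (induction k arbitrary: j \<epsilon>)
  case 0
  then show ?case by simp
next
  case (Suc k)
  have "\<forall>\<^sub>F n in sequentially. \<bar>(fdiff ^^ k) f (real n)\<bar> \<le> \<epsilon> * (real n ^ Suc j * harm n)"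
    if "\<epsilon> > 0" for \<epsilon>
  proof -
    define v where "v = (\<lambda>n. \<epsilon> / 2 * (real n ^ Suc j * harm n))"
    have "filterlim v at_top sequentially"
      using \<open>\<epsilon> > 0\<close> unfolding v_def
      by (intro filterlim_tendsto_pos_mult_at_top[OF tendsto_const] filterlim_power_harm_at_top) simp
    moreover have "\<forall>\<^sub>F n in sequentially.
        \<bar>(fdiff ^^ k) f (real (Suc n)) - (fdiff ^^ k) f (real n)\<bar> \<le> v (Suc n) - v n"
      using Suc.prems(1)[OF half_gt_zero[OF \<open>\<epsilon> > 0\<close>]] unfolding funpow_fdiff_Suc_of_nat
    proof eventually_elim
      case (elim n)
      have "real n ^ Suc j * harm n + real n ^ j * harm n = (real n ^ j * real (Suc n)) * harm n"
        by (simp add: algebra_simps)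
      also have "\<dots> \<le> real (Suc n) ^ Suc j * harm (Suc n)"
        by (intro mult_mono harm_mono) (auto simp: harm_nonneg intro!: mult_right_mono power_mono)
      finally have "\<epsilon> / 2 * (real n ^ j * harm n) \<le>
          \<epsilon> / 2 * (real (Suc n) ^ Suc j * harm (Suc n) - real n ^ Suc j * harm n)"
        using \<open>\<epsilon> > 0\<close> by (intro mult_left_mono) auto
      with elim show ?case by (simp only: v_def right_diff_distrib)
    qed
    ultimately have "\<forall>\<^sub>F n in sequentially. \<bar>(fdiff ^^ k) f (real n)\<bar> \<le> 2 * v n"
      by (rule eventually_abs_le_of_increments[rotated])
    then show ?thesis by (simp add: v_def)
  qed
  from Suc.IH[OF this Suc.prems(2)] show ?case by simp
qed

lemma fdiff_small_o_harm:
  assumes "((\<lambda>t. t * fdiff f t) \<longlongrightarrow> 0) at_top" "\<epsilon> > 0"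
  shows "\<forall>\<^sub>F n in sequentially. \<bar>f (real n)\<bar> \<le> \<epsilon> * harm n"
proof -
  define v where "v = (\<lambda>n. \<epsilon> / 2 * harm n)"
  have "filterlim v at_top sequentially"
    using \<open>\<epsilon> > 0\<close> unfolding v_def
    by (intro filterlim_tendsto_pos_mult_at_top[OF tendsto_const] harm_at_top) simp
  moreover have "((\<lambda>n. real n * fdiff f (real n)) \<longlongrightarrow> 0) sequentially"
    using filterlim_compose[OF assms(1) filterlim_real_sequentially] .
  \<comment> \<open>Since \<open>n + 1\<close> is at most \<open>2 * n\<close>, the bound
    \<open>\<epsilon> / (4 * n)\<close> does not exceed the increment
    \<open>\<epsilon> / (2 * (n + 1))\<close> of \<open>v\<close>.\<close>
  then have "\<forall>\<^sub>F n in sequentially. \<bar>real n * fdiff f (real n)\<bar> < \<epsilon> / 4"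
    using \<open>\<epsilon> > 0\<close> by (auto simp: tendsto_iff dist_real_def elim!: allE[of _ "\<epsilon> / 4"])
  then have "\<forall>\<^sub>F n in sequentially. \<bar>f (real (Suc n)) - f (real n)\<bar> \<le> v (Suc n) - v n"
    using eventually_ge_at_top[of 1]
  proof eventually_elim
    case (elim n)
    have "\<bar>fdiff f (real n)\<bar> \<le> (\<epsilon> / 4) / real n"
      using elim by (simp add: pos_le_divide_eq abs_mult mult_ac)
    also have "\<dots> \<le> \<epsilon> / 2 * inverse (real (Suc n))"
      using elim \<open>\<epsilon> > 0\<close> by (simp add: field_simps)
    finally show ?case by (simp add: v_def harm_Suc fdiff_def algebra_simps)
  qed
  ultimately have "\<forall>\<^sub>F n in sequentially. \<bar>f (real n)\<bar> \<le> 2 * v n"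
    by (rule eventually_abs_le_of_increments[rotated])
  then show ?thesis by (simp add: v_def)
qed

lemma eventually_harm_le: "\<forall>\<^sub>F n in sequentially. harm n \<le> 2 * ln (real n)"
proof -
  obtain L where L: "(\<lambda>n. harm n - ln (real n)) \<longlonglongrightarrow> L"
    using euler_mascheroni_convergent by (auto simp: convergent_def)
  have "\<forall>\<^sub>F n in sequentially. harm n - ln (real n) < L + 1"
    using L by (rule order_tendstoD) simp
  moreover have "\<forall>\<^sub>F n in sequentially. L + 1 \<le> ln (real n)"
    using filterlim_compose[OF ln_at_top filterlim_real_sequentially] by (auto simp: filterlim_at_top)
  ultimately show ?thesis by eventually_elim simp
qed

text \<open>Otherwise summing the differences \<open>d + 1\<close> times bounds
  \<open>\<bar>f n\<bar>\<close> by \<open>c / 4\<close> times \<open>n ^ d * harm n\<close>; as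
  \<open>harm n\<close> is eventually at most \<open>2 * ln n\<close>, this is only half of the
  assumed lower bound.\<close>

lemma ident_mult_funpow_fdiff_not_tendsto_0:
  assumes "\<forall>\<^sub>F t in at_top. c * (t ^ d * ln t) \<le> \<bar>f t\<bar>" "c > 0"
  shows "\<not> ((\<lambda>t. t * (fdiff ^^ Suc d) f t) \<longlongrightarrow> 0) at_top"
proof
  assume "((\<lambda>t. t * (fdiff ^^ Suc d) f t) \<longlongrightarrow> 0) at_top"
  then have "\<forall>\<^sub>F n in sequentially. \<bar>(fdiff ^^ d) f (real n)\<bar> \<le> \<epsilon> * (real n ^ 0 * harm n)"
    if "\<epsilon> > 0" for \<epsilon> using fdiff_small_o_harm[of "(fdiff ^^ d) f" \<epsilon>] that by simp
  then have "\<forall>\<^sub>F n in sequentially. \<bar>f (real n)\<bar> \<le> c / 4 * (real n ^ (0 + d) * harm n)"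
    by (rule funpow_fdiff_small_o_harm) (use \<open>c > 0\<close> in auto)
  moreover have "\<forall>\<^sub>F n in sequentially. c * (real n ^ d * ln (real n)) \<le> \<bar>f (real n)\<bar>"
    using assms(1) filterlim_real_sequentially unfolding filterlim_iff by fast
  ultimately have "\<forall>\<^sub>F n :: nat in sequentially. False"
    using eventually_harm_le eventually_ge_at_top[of 2]
  proof eventually_elim
    case (elim n)
    have "c / 4 * (real n ^ d * harm n) \<le> c / 4 * (real n ^ d * (2 * ln (real n)))"
      using elim(3) \<open>c > 0\<close> by (intro mult_left_mono) auto
    then have "c * (real n ^ d * ln (real n)) \<le> c / 4 * (real n ^ d * (2 * ln (real n)))"
      using elim(1,2) unfolding add_0 by linarith
    moreover have "c * (real n ^ d * ln (real n)) > 0"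
      using elim(4) \<open>c > 0\<close> by simp
    ultimately show False by (simp add: mult.commute)
  qed
  then show False by simp
qed

text \<open>Prepares the Kusmin-Landau estimate for the phases \<open>(fdiff ^^ d) f\<close>: up to
  the sign \<open>\<sigma>\<close> their increments decrease, and they are not smaller than
  \<open>c / t\<close>.\<close>

lemma hardy_field_funpow_fdiff_asymp:
  assumes H: "hardy_field H" "germ_of f \<in> H"
    and growth: "growth_less f (\<lambda>t. t ^ Suc d)"
      "\<forall>\<^sub>F t in at_top. c0 * (t ^ d * ln t) \<le> \<bar>f t\<bar>" "c0 > 0"
  obtains \<sigma> c t0 where "\<sigma> = 1 \<or> \<sigma> = (-1::real)" "c > 0"
    "\<And>t. t \<ge> t0 \<Longrightarrow> c \<le> t * (\<sigma> * (fdiff ^^ Suc d) f t)"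
    "\<And>s t. t0 \<le> s \<Longrightarrow> s \<le> t \<Longrightarrow> \<sigma> * (fdiff ^^ Suc d) f t \<le> \<sigma> * (fdiff ^^ Suc d) f s"
proof -
  define g where "g = (fdiff ^^ Suc d) f"
  have gH: "germ_of g \<in> H" unfolding g_def using H by (rule hardy_field_funpow_fdiff)
  have lim: "(g \<longlongrightarrow> 0) at_top"
    using H growth(1) unfolding g_def by (rule funpow_fdiff_tendsto_0)
  have "\<not> ((\<lambda>t. t * g t) \<longlongrightarrow> 0) at_top"
    using growth(2,3) unfolding g_def by (rule ident_mult_funpow_fdiff_not_tendsto_0)
  with hardy_field_ident_mult_mono_near_top[OF H(1) gH] obtain c where c: "c > 0"
    "(\<forall>\<^sub>F t in at_top. t * g t \<ge> c) \<or> (\<forall>\<^sub>F t in at_top. - (t * g t) \<ge> c)"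
    by (rule tendsto_0_or_bounded_away)
  then obtain \<sigma> where \<sigma>: "\<sigma> = 1 \<or> \<sigma> = (-1::real)" and ge: "\<forall>\<^sub>F t in at_top. c \<le> t * (\<sigma> * g t)"
    by fastforce
  \<comment> \<open>An increasing function with limit 0 is at most 0, whereas
    \<open>\<sigma> * g\<close> is eventually positive; so \<open>\<sigma> * g\<close> can only be
    decreasing.\<close>
  have "\<not> mono_near_top (\<lambda>t. \<sigma> * g t)"
  proof
    assume "mono_near_top (\<lambda>t. \<sigma> * g t)"
    then obtain t1 where t1: "mono_on {t1..} (\<lambda>t. \<sigma> * g t)" unfolding mono_near_top_def ..
    have "\<sigma> * g s \<le> 0" if "s \<ge> t1" for s
    proof (rule tendsto_lowerbound)
      show "((\<lambda>t. \<sigma> * g t) \<longlongrightarrow> 0) at_top"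
        using tendsto_mult_right_zero[OF lim] .
      show "\<forall>\<^sub>F t in at_top. \<sigma> * g s \<le> \<sigma> * g t"
        using eventually_ge_at_top[of s]
        by eventually_elim (use t1 that in \<open>auto simp: mono_on_def\<close>)
    qed simp
    then have "\<forall>\<^sub>F t in at_top. \<sigma> * g t \<le> 0" by (auto simp: eventually_at_top_linorder)
    with ge eventually_ge_at_top[of 0] have "\<forall>\<^sub>F t :: real in at_top. False"
      by eventually_elim (use c(1) mult_nonneg_nonpos in fastforce)
    then show False by simp
  qed
  moreover have "mono_near_top (\<lambda>t. \<sigma> * g t) \<or> mono_near_top (\<lambda>t. - (\<sigma> * g t))"
    using hardy_field_mono_near_top[OF H(1) gH] \<sigma> by auto
  ultimately obtain t1 where t1: "mono_on {t1..} (\<lambda>t. - (\<sigma> * g t))"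
    unfolding mono_near_top_def by blast
  obtain t2 where t2: "\<And>t. t \<ge> t2 \<Longrightarrow> c \<le> t * (\<sigma> * g t)"
    using ge by (auto simp: eventually_at_top_linorder)
  show thesis
  proof (rule that[of \<sigma> c "max t1 t2"]; (unfold g_def[symmetric])?)
    show "\<sigma> * g t \<le> \<sigma> * g s" if "max t1 t2 \<le> s" "s \<le> t" for s t
      using t1 that by (auto simp: mono_on_def)
  qed (use \<sigma> c t2 in auto)
qed

text \<open>Extracts from the two alternative growth conditions the upper and lower bounds that they
  share, so that they need not be distinguished later.\<close>

lemma growth_bounds:
  assumes "(growth_less (\<lambda>t. t ^ d * ln t) a \<and> growth_less a (\<lambda>t. t ^ (d + 1))) \<or>
           growth_equiv a (\<lambda>t. t ^ d * ln t)"
  obtains c where "c > 0" "\<forall>\<^sub>F t in at_top. c * (t ^ d * ln t) \<le> \<bar>a t\<bar>"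
    "growth_less a (\<lambda>t. t ^ Suc d)"
  using assms
proof
  assume *: "growth_less (\<lambda>t. t ^ d * ln t) a \<and> growth_less a (\<lambda>t. t ^ (d + 1))"
  then have "((\<lambda>t. t ^ d * ln t / a t) \<longlongrightarrow> 0) at_top" "\<forall>\<^sub>F t in at_top. a t \<noteq> 0"
    by (auto simp: growth_less_def)
  then have "\<forall>\<^sub>F t in at_top. \<bar>t ^ d * ln t / a t\<bar> < 1" "\<forall>\<^sub>F t in at_top. a t \<noteq> 0"
    by (auto simp: tendsto_iff dist_real_def elim!: allE[of _ "1::real"])
  then have "\<forall>\<^sub>F t in at_top. 1 * (t ^ d * ln t) \<le> \<bar>a t\<bar>"
    by eventually_elim (simp add: pos_divide_less_eq abs_mult[symmetric])
  with * show thesis by (intro that[of 1]) auto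
next
  assume "growth_equiv a (\<lambda>t. t ^ d * ln t)"
  then obtain c where c: "c \<noteq> 0" "((\<lambda>t. a t / (t ^ d * ln t)) \<longlongrightarrow> c) at_top"
    by (auto simp: growth_equiv_def)
  have "((\<lambda>t. \<bar>a t / (t ^ d * ln t)\<bar>) \<longlongrightarrow> \<bar>c\<bar>) at_top"
    using c(2) by (rule tendsto_rabs)
  then have "\<forall>\<^sub>F t in at_top. \<bar>c\<bar> / 2 < \<bar>a t / (t ^ d * ln t)\<bar>"
    using c(1) by (intro order_tendstoD) auto
  then have "\<forall>\<^sub>F t in at_top. \<bar>c\<bar> / 2 * (t ^ d * ln t) \<le> \<bar>a t\<bar>"
    using eventually_gt_at_top[of 1]
    by eventually_elim (simp add: pos_less_divide_eq abs_mult)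
  \<comment> \<open>The factor \<open>ln t / t\<close> tends to 0 and turns the denominator
    \<open>t ^ d * ln t\<close> into \<open>t ^ Suc d\<close>.\<close>
  moreover have "((\<lambda>t. a t / (t ^ d * ln t) * (ln t / t)) \<longlongrightarrow> c * 0) at_top"
    by (intro tendsto_mult c(2) ln_x_over_x_tendsto_0)
  then have "((\<lambda>t. a t / t ^ Suc d) \<longlongrightarrow> 0) at_top"
    unfolding mult_zero_right
  proof (rule Lim_transform_eventually)
    show "\<forall>\<^sub>F t in at_top. a t / (t ^ d * ln t) * (ln t / t) = a t / t ^ Suc d"
      using eventually_gt_at_top[of 1] by eventually_elim (simp add: field_simps)
  qed
  then have "growth_less a (\<lambda>t. t ^ Suc d)"
    unfolding growth_less_def
    by (intro conjI eventually_mono[OF eventually_gt_at_top[of 0]]) auto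
  ultimately show thesis using c(1) by (intro that[of "\<bar>c\<bar> / 2"]) auto
qed

section \<open>Exponential sums\<close>

definition e_real :: "real \<Rightarrow> complex" where
  "e_real t = cis (2 * pi * t)"

lemma norm_e_real [simp]: "norm (e_real t) = 1"
  by (simp add: e_real_def)

lemma e_real_0 [simp]: "e_real 0 = 1"
  by (simp add: e_real_def)

lemma e_real_nonzero [simp]: "e_real t \<noteq> 0"
  by (simp add: e_real_def)

lemma e_real_add: "e_real (s + t) = e_real s * e_real t"
  by (simp add: e_real_def cis_mult algebra_simps)

lemma e_real_diff: "e_real (s - t) = e_real s / e_real t"
  by (simp add: e_real_def cis_divide algebra_simps)

lemma cnj_e_real: "cnj (e_real t) = e_real (- t)"
  by (simp add: e_real_def cis_cnj)

lemma e_real_power_int: "e_real t powi k = e_real (of_int k * t)"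
  by (simp add: e_real_def cis_power_int algebra_simps)

lemma e_real_eq_1_iff: "e_real t = 1 \<longleftrightarrow> t \<in> \<int>"
proof
  assume "e_real t = 1"
  then have "cos (2 * pi * t) = 1"
    by (simp add: e_real_def complex_eq_iff)
  then show "t \<in> \<int>" by (auto simp: cos_one_2pi_int)
next
  assume "t \<in> \<int>"
  then show "e_real t = 1" by (simp add: e_real_def)
qed

lemma has_vector_derivative_e_real:
  "(e_real has_vector_derivative 2 * pi *\<^sub>R (\<i> * e_real t)) (at t within A)"
  unfolding e_real_def
  by (auto intro!: derivative_eq_intros simp: has_vector_derivative_def scaleR_conv_of_real mult_ac)

lemma norm_e_real_diff_le: "norm (e_real s - e_real t) \<le> 2 * pi * \<bar>s - t\<bar>"
proof -
  have "norm (e_real s - e_real t) \<le> 2 * pi * norm (s - t)"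
  proof (rule differentiable_bound[OF convex_UNIV])
    show "(e_real has_derivative (\<lambda>h. h *\<^sub>R (2 * pi *\<^sub>R (\<i> * e_real x)))) (at x within UNIV)" for x
      using has_vector_derivative_e_real[of x UNIV] by (simp add: has_vector_derivative_def)
    show "onorm (\<lambda>h. h *\<^sub>R (2 * pi *\<^sub>R (\<i> * e_real x))) \<le> 2 * pi" for x
      by (rule onorm_le) (simp add: norm_mult abs_mult)
  qed auto
  then show ?thesis by simp
qed

lemma e_real_tendsto_1:
  assumes "(f \<longlongrightarrow> 0) F"
  shows "((\<lambda>x. e_real (f x)) \<longlongrightarrow> 1) F"
  unfolding e_real_def using tendsto_cis[OF tendsto_mult_right_zero[OF assms, of "2 * pi"]] by simp

text \<open>The imaginary part of \<open>e_real t - 1\<close> is \<open>sin (2 * pi * t)\<close>,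
  whose slope \<open>2 * pi\<close> at 0 exceeds 1.\<close>

lemma norm_e_real_minus_1_ge:
  obtains \<eta> where "\<eta> > 0" "\<And>t. \<bar>t\<bar> < \<eta> \<Longrightarrow> \<bar>t\<bar> \<le> norm (e_real t - 1)"
proof -
  have "((\<lambda>t. sin (2 * pi * t)) has_real_derivative 2 * pi) (at 0)"
    by (auto intro!: derivative_eq_intros)
  then have "((\<lambda>t. \<bar>sin (2 * pi * t) / t\<bar>) \<longlongrightarrow> \<bar>2 * pi\<bar>) (at 0)"
    by (intro tendsto_rabs) (simp add: DERIV_def)
  then have "\<forall>\<^sub>F t in at 0. 1 < \<bar>sin (2 * pi * t) / t\<bar>"
    using pi_gt3 by (intro order_tendstoD) auto
  then obtain \<eta> where \<eta>: "\<eta> > 0" "\<And>t. t \<noteq> 0 \<Longrightarrow> \<bar>t\<bar> < \<eta> \<Longrightarrow> 1 < \<bar>sin (2 * pi * t) / t\<bar>"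
    by (auto simp: eventually_at)
  show thesis
  proof (rule that[OF \<eta>(1)])
    fix t assume "\<bar>t\<bar> < \<eta>"
    then have "\<bar>t\<bar> \<le> \<bar>Im (e_real t - 1)\<bar>"
      using \<eta>(2)[of t] by (cases "t = 0") (auto simp: e_real_def field_simps)
    also have "\<dots> \<le> norm (e_real t - 1)" by (rule abs_Im_le_cmod)
    finally show "\<bar>t\<bar> \<le> norm (e_real t - 1)" .
  qed
qed

text \<open>The right-hand side telescopes when summed along a decreasing sequence of increments,
  which bounds the total variation of the weights in the summation by parts.\<close>

lemma inverse_e_real_diff_le:
  assumes "0 < s" "s \<le> t" "s \<le> norm (e_real s - 1)" "t \<le> norm (e_real t - 1)"
  shows "norm (inverse (e_real s - 1) - inverse (e_real t - 1)) \<le> 2 * pi * (1 / s - 1 / t)"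
proof -
  have nz: "e_real s - 1 \<noteq> 0" "e_real t - 1 \<noteq> 0" using assms by auto
  have "norm (inverse (e_real s - 1) - inverse (e_real t - 1)) =
      norm (e_real t - e_real s) / (norm (e_real s - 1) * norm (e_real t - 1))"
    using nz by (simp add: field_simps norm_divide[symmetric] norm_mult[symmetric])
  also have "\<dots> \<le> (2 * pi * \<bar>t - s\<bar>) / (s * t)"
    using assms by (intro frac_le norm_e_real_diff_le mult_mono mult_pos_pos) auto
  also have "\<dots> = 2 * pi * (1 / s - 1 / t)"
    using assms by (simp add: field_simps)
  finally show ?thesis .
qed

text \<open>Summation by parts, based on
  \<open>e(\<theta>\<^sub>n) = (e(\<theta>\<^sub>n\<^sub>+\<^sub>1) - e(\<theta>\<^sub>n)) / (e(\<theta>\<^sub>n\<^sub>+\<^sub>1 - \<theta>\<^sub>n) - 1)\<close>.\<close>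

lemma Kusmin_Landau:
  fixes \<theta> :: "nat \<Rightarrow> real"
  defines "\<delta> \<equiv> \<lambda>n. \<theta> (Suc n) - \<theta> n"
  assumes pos: "\<And>n. n \<ge> n0 \<Longrightarrow> 0 < \<delta> n"
    and anti: "\<And>n. n \<ge> n0 \<Longrightarrow> \<delta> (Suc n) \<le> \<delta> n"
    and ge: "\<And>n. n \<ge> n0 \<Longrightarrow> \<delta> n \<le> norm (e_real (\<delta> n) - 1)"
    and N: "n0 \<le> N"
  shows "norm (\<Sum>n=n0..N. e_real (\<theta> n)) \<le> (2 + 2 * pi) / \<delta> N"
proof -
  define w where "w n = inverse (e_real (\<delta> n) - 1)" for n
  have eq: "e_real (\<theta> n) = (e_real (\<theta> (Suc n)) - e_real (\<theta> n)) * w n" if "n \<ge> n0" for n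
  proof -
    have "e_real (\<delta> n) - 1 \<noteq> 0" using pos[OF that] ge[OF that] by auto
    moreover have "e_real (\<theta> (Suc n)) = e_real (\<theta> n) * e_real (\<delta> n)"
      by (simp add: \<delta>_def e_real_add[symmetric])
    ultimately show ?thesis by (simp add: w_def field_simps)
  qed
  have w_le: "norm (w n) \<le> 1 / \<delta> n" if "n \<ge> n0" for n
    using pos[OF that] ge[OF that] unfolding w_def norm_inverse
    by (simp add: inverse_eq_divide frac_le)
  \<comment> \<open>With the boundary term subtracted, passing from \<open>N\<close> to
    \<open>Suc N\<close> adds just \<open>w (Suc N) - w N\<close> times a number of modulus 1, and
    the bounds for these variations telescope.\<close>
  have "norm ((\<Sum>n=n0..N. e_real (\<theta> n)) - e_real (\<theta> (Suc N)) * w N) \<le>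
      1 / \<delta> n0 + 2 * pi * (1 / \<delta> N - 1 / \<delta> n0)"
    using N
  proof (induction N rule: dec_induct)
    case base
    have "(\<Sum>n=n0..n0. e_real (\<theta> n)) - e_real (\<theta> (Suc n0)) * w n0 = - e_real (\<theta> n0) * w n0"
      using eq[of n0] by (simp add: algebra_simps)
    then show ?case using w_le[of n0] by (simp add: norm_mult)
  next
    case (step N)
    have "(\<Sum>n=n0..Suc N. e_real (\<theta> n)) - e_real (\<theta> (Suc (Suc N))) * w (Suc N) =
      ((\<Sum>n=n0..N. e_real (\<theta> n)) - e_real (\<theta> (Suc N)) * w N) - e_real (\<theta> (Suc N)) * (w (Suc N) - w N)"
      using eq[of "Suc N"] step by (simp add: algebra_simps)
    also have "norm \<dots> \<le> norm ((\<Sum>n=n0..N. e_real (\<theta> n)) - e_real (\<theta> (Suc N)) * w N) +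
        norm (w (Suc N) - w N)"
      by (rule order_trans[OF norm_triangle_ineq4]) (simp add: norm_mult)
    also have "norm (w (Suc N) - w N) \<le> 2 * pi * (1 / \<delta> (Suc N) - 1 / \<delta> N)"
      unfolding w_def using step pos anti ge by (intro inverse_e_real_diff_le) auto
    finally show ?case using step.IH by (simp add: algebra_simps)
  qed
  moreover have "norm (e_real (\<theta> (Suc N)) * w N) \<le> 1 / \<delta> N"
    using w_le[OF N] by (simp add: norm_mult)
  moreover have "1 / \<delta> n0 \<le> 1 / \<delta> N"
  proof -
    have "\<delta> N \<le> \<delta> n0" using N
      by (induction N rule: dec_induct) (auto intro: order_trans anti)
    then show ?thesis using pos[OF N] by (intro divide_left_mono) (auto intro!: mult_pos_pos pos)
  qed
  moreover have "norm (\<Sum>n=n0..N. e_real (\<theta> n)) \<le>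
    norm ((\<Sum>n=n0..N. e_real (\<theta> n)) - e_real (\<theta> (Suc N)) * w N) + norm (e_real (\<theta> (Suc N)) * w N)"
    by (metis diff_add_cancel norm_triangle_ineq)
  moreover have "2 * pi * (1 / \<delta> N - 1 / \<delta> n0) \<le> 2 * pi * (1 / \<delta> N)"
    using pos[of n0] by (intro mult_left_mono) auto
  ultimately show ?thesis by (simp add: add_divide_distrib algebra_simps)
qed

text \<open>Kusmin-Landau applies from the index \<open>n1\<close> on, where the last increment is
  at least \<open>c * h / N\<close>; the terms before \<open>n1\<close> are estimated
  trivially.\<close>

lemma exponential_sum_bound:
  fixes \<theta> :: "nat \<Rightarrow> real"
  assumes lim: "(\<lambda>n. \<theta> (Suc n) - \<theta> n) \<longlonglongrightarrow> 0" and c: "c > 0" and h: "h > 0"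
    and ge: "\<And>n. n \<ge> n0 \<Longrightarrow> c \<le> real n * (\<theta> (Suc n) - \<theta> n)"
    and anti: "\<And>n. n \<ge> n0 \<Longrightarrow> \<theta> (Suc (Suc n)) - \<theta> (Suc n) \<le> \<theta> (Suc n) - \<theta> n"
  obtains n1 where
    "\<And>N. N \<ge> n1 \<Longrightarrow> norm (\<Sum>n=1..N. e_real (h * \<theta> n)) \<le> real n1 + (2 + 2 * pi) / (c * h) * real N"
proof -
  obtain \<eta> where \<eta>: "\<eta> > 0" "\<And>t. \<bar>t\<bar> < \<eta> \<Longrightarrow> \<bar>t\<bar> \<le> norm (e_real t - 1)"
    using norm_e_real_minus_1_ge by blast
  have "(\<lambda>n. h * (\<theta> (Suc n) - \<theta> n)) \<longlonglongrightarrow> 0"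
    using tendsto_mult_right_zero[OF lim] .
  then have "\<forall>\<^sub>F n in sequentially. \<bar>h * (\<theta> (Suc n) - \<theta> n)\<bar> < \<eta>"
    using \<eta>(1) by (auto simp: tendsto_iff dist_real_def)
  then obtain m where m: "\<And>n. n \<ge> m \<Longrightarrow> \<bar>h * (\<theta> (Suc n) - \<theta> n)\<bar> < \<eta>"
    by (auto simp: eventually_sequentially)
  \<comment> \<open>From \<open>m\<close> on, the increments are small enough for
    \<open>norm_e_real_minus_1_ge\<close>; the successor also makes every \<open>N \<ge> n1\<close>
    positive.\<close>
  define n1 where "n1 = Suc (max m n0)"
  have pos: "0 < \<theta> (Suc n) - \<theta> n" if "n \<ge> n0" for n
  proof -
    have "0 < real n * (\<theta> (Suc n) - \<theta> n)" using ge[OF that] c by linarith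
    then show ?thesis by (simp add: zero_less_mult_iff)
  qed
  show thesis
  proof (rule that[of n1])
    fix N assume N: "N \<ge> n1"
    have "norm (\<Sum>n=n1..N. e_real (h * \<theta> n)) \<le> (2 + 2 * pi) / (h * \<theta> (Suc N) - h * \<theta> N)"
    proof (rule Kusmin_Landau[OF _ _ _ N])
      fix n assume "n1 \<le> n"
      then have n: "n \<ge> m" "n \<ge> n0" by (auto simp: n1_def)
      show p: "0 < h * \<theta> (Suc n) - h * \<theta> n"
        using pos[OF n(2)] h by (simp add: right_diff_distrib[symmetric])
      show "h * \<theta> (Suc (Suc n)) - h * \<theta> (Suc n) \<le> h * \<theta> (Suc n) - h * \<theta> n"
        using anti[OF n(2)] h unfolding right_diff_distrib[symmetric] by (intro mult_left_mono) auto
      show "h * \<theta> (Suc n) - h * \<theta> n \<le> norm (e_real (h * \<theta> (Suc n) - h * \<theta> n) - 1)"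
        using \<eta>(2) m[OF n(1)] p unfolding right_diff_distrib[symmetric] by fastforce
    qed
    also have "\<dots> \<le> (2 + 2 * pi) / (c * h / real N)"
    proof (rule divide_left_mono)
      have N': "N \<ge> n0" "N > 0" using N by (auto simp: n1_def)
      then have "c \<le> real N * (\<theta> (Suc N) - \<theta> N)" by (intro ge)
      then have "c * h \<le> real N * (\<theta> (Suc N) - \<theta> N) * h" using h by (intro mult_right_mono) auto
      then have "c * h \<le> (h * \<theta> (Suc N) - h * \<theta> N) * real N" by (simp add: algebra_simps)
      then show "c * h / real N \<le> h * \<theta> (Suc N) - h * \<theta> N"
        using N'(2) by (simp add: pos_divide_le_eq)
      show "0 < (h * \<theta> (Suc N) - h * \<theta> N) * (c * h / real N)"
        using N' c h pos[OF N'(1)] by (simp add: right_diff_distrib[symmetric])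
    qed simp
    also have "\<dots> = (2 + 2 * pi) / (c * h) * real N" by simp
    finally have 1: "norm (\<Sum>n=n1..N. e_real (h * \<theta> n)) \<le> (2 + 2 * pi) / (c * h) * real N" .
    have "norm (\<Sum>n=1..<n1. e_real (h * \<theta> n)) \<le> (\<Sum>n=1..<n1. norm (e_real (h * \<theta> n)))"
      by (rule norm_sum)
    also have "\<dots> \<le> real n1" by simp
    finally have 2: "norm (\<Sum>n=1..<n1. e_real (h * \<theta> n)) \<le> real n1" .
    have "{1..N} = {1..<n1} \<union> {n1..N}" using N by (auto simp: n1_def)
    moreover have "{1..<n1} \<inter> {n1..N} = {}" by auto
    ultimately have "(\<Sum>n=1..N. e_real (h * \<theta> n)) =
        (\<Sum>n=1..<n1. e_real (h * \<theta> n)) + (\<Sum>n=n1..N. e_real (h * \<theta> n))"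
      by (metis finite_atLeastAtMost finite_atLeastLessThan sum.union_disjoint)
    with 1 2 norm_triangle_ineq show "norm (\<Sum>n=1..N. e_real (h * \<theta> n)) \<le>
        real n1 + (2 + 2 * pi) / (c * h) * real N"
      by (smt (verit))
  qed
qed

text \<open>Dividing the bound for the sums by \<open>K k\<close> removes the initial segment in the
  limit. The bound is applied to \<open>\<bar>h\<bar>\<close> and
  \<open>\<sigma> * \<theta>\<close>, which are of the required sign.\<close>

lemma e_real_average_limit_bound:
  fixes \<theta> :: "nat \<Rightarrow> real" and K :: "nat \<Rightarrow> nat"
  assumes lim: "(\<lambda>n. \<theta> (Suc n) - \<theta> n) \<longlonglongrightarrow> 0" and c: "c > 0" and h: "h \<noteq> 0"
    and \<sigma>: "\<sigma> = 1 \<or> \<sigma> = (-1::real)"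
    and ge: "\<And>n. n \<ge> n0 \<Longrightarrow> c \<le> real n * (\<sigma> * (\<theta> (Suc n) - \<theta> n))"
    and anti: "\<And>n. n \<ge> n0 \<Longrightarrow> \<sigma> * (\<theta> (Suc (Suc n)) - \<theta> (Suc n)) \<le> \<sigma> * (\<theta> (Suc n) - \<theta> n)"
    and K: "strict_mono K" "\<And>k. K k > 0"
    and z: "(\<lambda>k. (\<Sum>n=1..K k. e_real (h * \<theta> n)) / of_nat (K k)) \<longlonglongrightarrow> z"
  shows "norm z \<le> (2 + 2 * pi) / (c * \<bar>h\<bar>)"
proof -
  have "(\<lambda>n. \<sigma> * \<theta> (Suc n) - \<sigma> * \<theta> n) \<longlonglongrightarrow> 0"
    using tendsto_mult_right_zero[OF lim, of \<sigma>] by (simp add: right_diff_distrib)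
  moreover have "\<bar>h\<bar> > 0" using h by simp
  ultimately obtain n1 where n1: "\<And>N. N \<ge> n1 \<Longrightarrow>
      norm (\<Sum>n=1..N. e_real (\<bar>h\<bar> * (\<sigma> * \<theta> n))) \<le> real n1 + (2 + 2 * pi) / (c * \<bar>h\<bar>) * real N"
    using exponential_sum_bound[of "\<lambda>n. \<sigma> * \<theta> n" c "\<bar>h\<bar>" n0] c ge anti
    by (auto simp: right_diff_distrib)
  \<comment> \<open>A wrong sign only conjugates the sum and leaves its modulus unchanged.\<close>
  have "\<bar>h\<bar> * \<sigma> = h \<or> \<bar>h\<bar> * \<sigma> = - h" using \<sigma> by (auto simp: abs_if)
  then have same: "norm (\<Sum>n=1..N. e_real (\<bar>h\<bar> * (\<sigma> * \<theta> n))) = norm (\<Sum>n=1..N. e_real (h * \<theta> n))" for N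
  proof
    assume "\<bar>h\<bar> * \<sigma> = - h"
    then have "(\<Sum>n=1..N. e_real (\<bar>h\<bar> * (\<sigma> * \<theta> n))) = cnj (\<Sum>n=1..N. e_real (h * \<theta> n))"
      by (simp add: mult.assoc[symmetric] cnj_e_real)
    then show ?thesis by (simp only: complex_mod_cnj)
  qed (simp add: mult.assoc[symmetric])
  have K_lim: "filterlim K at_top sequentially" using K(1) by (rule filterlim_subseq)
  have "(\<lambda>k. real n1 / real (K k) + (2 + 2 * pi) / (c * \<bar>h\<bar>)) \<longlonglongrightarrow> 0 + (2 + 2 * pi) / (c * \<bar>h\<bar>)"
    by (intro tendsto_add tendsto_const tendsto_divide_0[OF tendsto_const]
        filterlim_at_top_imp_at_infinity filterlim_compose[OF filterlim_real_sequentially K_lim])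
  moreover have "(\<lambda>k. norm ((\<Sum>n=1..K k. e_real (h * \<theta> n)) / of_nat (K k))) \<longlonglongrightarrow> norm z"
    using z by (rule tendsto_norm)
  moreover have "\<forall>\<^sub>F k in sequentially. norm ((\<Sum>n=1..K k. e_real (h * \<theta> n)) / of_nat (K k)) \<le>
      real n1 / real (K k) + (2 + 2 * pi) / (c * \<bar>h\<bar>)"
  proof -
    have "\<forall>\<^sub>F k in sequentially. K k \<ge> n1" using K_lim by (auto simp: filterlim_at_top)
    then show ?thesis
    proof eventually_elim
      case (elim k)
      have "norm (\<Sum>n=1..K k. e_real (h * \<theta> n)) / real (K k) \<le>
          (real n1 + (2 + 2 * pi) / (c * \<bar>h\<bar>) * real (K k)) / real (K k)"
        using n1[OF elim] unfolding same by (intro divide_right_mono) auto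
      also have "\<dots> = real n1 / real (K k) + (2 + 2 * pi) / (c * \<bar>h\<bar>)"
        using K(2)[of k] by (simp add: add_divide_distrib)
      finally show ?case by (simp add: norm_divide)
    qed
  qed
  ultimately show ?thesis by (intro tendsto_le[of sequentially]) auto
qed

section \<open>Joinings with ergodic systems\<close>

lemma distr_funpow:
  assumes [measurable]: "T \<in> M \<rightarrow>\<^sub>M M" and T: "distr M M T = M"
  shows "distr M M (T ^^ n) = M"
proof (induction n)
  case 0
  show ?case by (simp add: id_def distr_id)
next
  case (Suc n)
  have "distr M M (T ^^ Suc n) = distr (distr M M (T ^^ n)) M T"
    by (subst distr_distr) auto
  also have "\<dots> = M" by (simp only: Suc.IH T)
  finally show ?case .
qed

lemma borel_measurable_cnj [measurable]: "cnj \<in> borel_measurable borel"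
  by (intro borel_measurable_continuous_onI continuous_intros)

lemma integral_funpow:
  fixes f :: "'a \<Rightarrow> 'b::{banach, second_countable_topology}"
  assumes [measurable]: "T \<in> M \<rightarrow>\<^sub>M M" "f \<in> borel_measurable M" and T: "distr M M T = M"
  shows "(\<integral>x. f ((T ^^ n) x) \<partial>M) = (\<integral>x. f x \<partial>M)"
proof -
  have "(\<integral>x. f x \<partial>M) = (\<integral>x. f x \<partial>distr M M (T ^^ n))"
    using distr_funpow[OF assms(1) T] by simp
  also have "\<dots> = (\<integral>x. f ((T ^^ n) x) \<partial>M)"
    by (rule integral_distr) auto
  finally show ?thesis by simp
qed

text \<open>Jensen's inequality for the square, obtained from the non-negative variance of
  \<open>norm (f x)\<close>.\<close>

lemma (in prob_space) norm_integral_square_le: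
  fixes f :: "'a \<Rightarrow> complex"
  assumes [measurable]: "f \<in> borel_measurable M" and bound: "\<And>x. norm (f x) \<le> C"
  shows "(norm (\<integral>x. f x \<partial>M))\<^sup>2 \<le> (\<integral>x. (norm (f x))\<^sup>2 \<partial>M)"
proof -
  have "norm (\<integral>x. f x \<partial>M) \<le> (\<integral>x. norm (f x) \<partial>M)" by (rule integral_norm_bound)
  then have "(norm (\<integral>x. f x \<partial>M))\<^sup>2 \<le> (\<integral>x. norm (f x) \<partial>M)\<^sup>2"
    by (intro power_mono) auto
  also have "\<dots> \<le> (\<integral>x. (norm (f x))\<^sup>2 \<partial>M)"
  proof -
    have "integrable M (\<lambda>x. norm (f x))"
      by (rule integrable_const_bound[of _ C]) (use bound in auto)
    moreover have "integrable M (\<lambda>x. (norm (f x))\<^sup>2)"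
      by (rule integrable_const_bound[of _ "C\<^sup>2"]) (use bound in \<open>auto intro!: power_mono\<close>)
    ultimately show ?thesis
      using variance_eq[of "\<lambda>x. norm (f x)"] variance_positive[of "\<lambda>x. norm (f x)"] by simp
  qed
  finally show ?thesis .
qed

text \<open>Van der Corput's trick: along a sparse enough arithmetic progression the iterates of \<open>u\<close> are
  nearly orthogonal, so that their averages are small in mean square.\<close>

lemma van_der_Corput:
  fixes u :: "'a \<Rightarrow> complex"
  assumes J: "prob_space J" and R [measurable]: "R \<in> J \<rightarrow>\<^sub>M J" and inv: "distr J J R = J"
    and u [measurable]: "u \<in> borel_measurable J" and bound: "\<And>z. norm (u z) \<le> 1"
    and \<epsilon>: "\<epsilon> \<longlonglongrightarrow> (0::real)"
    and corr: "\<And>h. h > 0 \<Longrightarrow> norm (\<integral>z. u ((R ^^ h) z) * cnj (u z) \<partial>J) \<le> \<epsilon> h"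
  shows "(\<integral>z. u z \<partial>J) = 0"
proof -
  interpret prob_space J by fact
  have bdd: "norm (u x * cnj (u y)) \<le> 1" for x y
    using mult_mono[OF bound[of x] bound[of y]] by (simp add: norm_mult)
  have int1: "integrable J (\<lambda>z. u ((R ^^ i) z))" for i
    by (rule integrable_const_bound[of _ 1]) (use bound in auto)
  have int2: "integrable J (\<lambda>z. u ((R ^^ i) z) * cnj (u ((R ^^ j) z)))" for i j
    by (rule integrable_const_bound[of _ 1]) (use bdd in auto)
  have lim: "(norm (\<integral>z. u z \<partial>J))\<^sup>2 \<le> 1 / real n + \<delta>" if \<delta>: "\<delta> > 0" and n: "n > 0" for \<delta> n
  proof -
    \<comment> \<open>All gaps in the progression of step \<open>h\<close> are multiples of
      \<open>h\<close>, so the correlations between its members are at most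
      \<open>\<delta>\<close>.\<close>
    obtain h where h: "h > 0" "\<And>k. k \<ge> h \<Longrightarrow> \<epsilon> k \<le> \<delta>"
    proof -
      have "\<forall>\<^sub>F k in sequentially. \<epsilon> k < \<delta>" using \<epsilon> \<delta> by (rule order_tendstoD)
      then obtain k0 where "\<And>k. k \<ge> k0 \<Longrightarrow> \<epsilon> k < \<delta>" by (auto simp: eventually_sequentially)
      then show thesis by (intro that[of "Suc k0"]) (auto intro: less_imp_le)
    qed
    define U where "U j z = u ((R ^^ (h * j)) z)" for j z
    have [measurable]: "U j \<in> borel_measurable J" for j unfolding U_def by measurable
    have off: "norm (\<integral>z. U j z * cnj (U k z) \<partial>J) \<le> \<delta>" if "k < j" for j k
    proof -
      define v where "v z = u ((R ^^ (h * (j - k))) z) * cnj (u z)" for z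
      have [measurable]: "v \<in> borel_measurable J" unfolding v_def by measurable
      have "h * j = h * (j - k) + h * k" using that by (simp add: add_mult_distrib2[symmetric])
      then have "U j z * cnj (U k z) = v ((R ^^ (h * k)) z)" for z
        by (simp add: U_def v_def funpow_add)
      then have "(\<integral>z. U j z * cnj (U k z) \<partial>J) = (\<integral>z. v z \<partial>J)"
        using integral_funpow[OF R _ inv, of v "h * k"] by simp
      also have "norm \<dots> \<le> \<epsilon> (h * (j - k))"
        unfolding v_def using h(1) that by (intro corr) auto
      also have "\<dots> \<le> \<delta>" using that h(1) by (intro h(2)) auto
      finally show ?thesis .
    qed
    have all: "norm (\<integral>z. U j z * cnj (U k z) \<partial>J) \<le> (if j = k then 1 else 0) + \<delta>" for j k
    proof (cases j k rule: linorder_cases)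
      case less
      have "(\<integral>z. U j z * cnj (U k z) \<partial>J) = cnj (\<integral>z. U k z * cnj (U j z) \<partial>J)"
        using Bochner_Integration.integral_cnj[of J "\<lambda>z. U k z * cnj (U j z)"]
        by (simp add: mult.commute)
      with off[OF less] less show ?thesis by simp
    next
      case equal
      have "norm (\<integral>z. U j z * cnj (U k z) \<partial>J) \<le> (\<integral>z. norm (U j z * cnj (U k z)) \<partial>J)"
        by (rule integral_norm_bound)
      also have "\<dots> \<le> 1"
        by (rule integral_le_const) (use bdd int2 in \<open>auto simp: U_def\<close>)
      finally show ?thesis using equal \<delta> by simp
    next
      case greater
      then show ?thesis using off by simp
    qed
    define A where "A z = (\<Sum>j<n. U j z)" for z
    have [measurable]: "A \<in> borel_measurable J" unfolding A_def by measurable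
    have A_bound: "norm (A z) \<le> real n" for z
      unfolding A_def U_def using sum_norm_bound[of "{..<n}" "\<lambda>j. u ((R ^^ (h * j)) z)" 1] bound by simp
    have sq: "complex_of_real ((norm (A z))\<^sup>2) = (\<Sum>j<n. \<Sum>k<n. U j z * cnj (U k z))" for z
      unfolding complex_norm_square A_def cnj_sum sum_product ..
    have "(\<integral>z. A z \<partial>J) = (\<Sum>j<n. \<integral>z. U j z \<partial>J)"
      unfolding A_def U_def using int1 by (intro Bochner_Integration.integral_sum) auto
    also have "\<dots> = of_nat n * (\<integral>z. u z \<partial>J)"
      unfolding U_def using integral_funpow[OF R u inv] by simp
    finally have "real n ^ 2 * (norm (\<integral>z. u z \<partial>J))\<^sup>2 = (norm (\<integral>z. A z \<partial>J))\<^sup>2"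
      by (simp add: norm_mult power_mult_distrib)
    also have "\<dots> \<le> (\<integral>z. (norm (A z))\<^sup>2 \<partial>J)"
      using A_bound by (intro norm_integral_square_le) auto
    also have "\<dots> = norm (\<integral>z. complex_of_real ((norm (A z))\<^sup>2) \<partial>J)"
      by (simp only: integral_complex_of_real norm_of_real) simp
    also have "\<dots> = norm (\<Sum>j<n. \<Sum>k<n. \<integral>z. U j z * cnj (U k z) \<partial>J)"
      unfolding sq U_def using int2
      by (subst Bochner_Integration.integral_sum, simp, subst Bochner_Integration.integral_sum) auto
    also have "\<dots> \<le> (\<Sum>j<n. \<Sum>k<n. (if j = k then 1 else 0) + \<delta>)"
      by (intro sum_norm_le all)
    also have "\<dots> = real n + real n ^ 2 * \<delta>"
      by (simp add: sum.distrib power2_eq_square distrib_left)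
    finally have "real n ^ 2 * (norm (\<integral>z. u z \<partial>J))\<^sup>2 \<le> real n ^ 2 * (1 / real n + \<delta>)"
      using n by (simp add: algebra_simps power2_eq_square)
    then show ?thesis using n by simp
  qed
  have "(norm (\<integral>z. u z \<partial>J))\<^sup>2 \<le> 0"
  proof (rule tendsto_lowerbound)
    \<comment> \<open>The tolerance is coupled to the number of iterates by taking
      \<open>\<delta> = 1 / n\<close>.\<close>
    have "(\<lambda>n. 1 / real n + 1 / real n) \<longlonglongrightarrow> 0 + 0" by (intro tendsto_intros lim_1_over_n)
    then show "(\<lambda>n. 1 / real n + 1 / real n) \<longlonglongrightarrow> 0" by simp
    show "\<forall>\<^sub>F n in sequentially. (norm (\<integral>z. u z \<partial>J))\<^sup>2 \<le> 1 / real n + 1 / real n"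
      using eventually_gt_at_top[of 0] by eventually_elim (rule lim, auto)
  qed simp
  then show ?thesis by simp
qed

text \<open>The density of \<open>\<nu>\<close> with respect to \<open>N\<close> is invariant under
  \<open>S\<close>, and ergodicity makes it constant; the constant is the total mass of
  \<open>\<nu>\<close>.\<close>

lemma ergodic_absolutely_continuous_invariant:
  fixes N :: "'y::compact_metric_space measure"
  assumes erg: "ergodic_system N S" and sets: "sets \<nu> = sets N"
    and ac: "absolutely_continuous N \<nu>" and fin: "emeasure \<nu> UNIV \<noteq> \<infinity>"
    and inv: "\<And>B. B \<in> sets N \<Longrightarrow> emeasure \<nu> (S -` B) = emeasure \<nu> B"
    and B: "B \<in> sets N"
  shows "emeasure \<nu> B = emeasure \<nu> UNIV * emeasure N B"
proof -
  have setsN: "sets N = sets borel" and N: "prob_space N" and [measurable]: "S \<in> N \<rightarrow>\<^sub>M N"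
    and S': "inv S \<in> N \<rightarrow>\<^sub>M N" and bij: "bij S" and SN: "distr N N S = N"
    using erg by (auto simp: ergodic_system_def measure_preserving_system_def)
  interpret N: prob_space N by fact
  have space: "space N = UNIV" using sets_eq_imp_space_eq[OF setsN] by simp
  obtain f where f [measurable]: "f \<in> borel_measurable N" and \<nu>: "density N f = \<nu>"
    using N.Radon_Nikodym[OF ac sets] by blast
  have "AE y in N. f (S y) = f y"
  proof (rule N.density_unique)
    show "density N (\<lambda>y. f (S y)) = density N f"
    proof (rule measure_eqI)
      fix B assume "B \<in> sets (density N (\<lambda>y. f (S y)))"
      then have B [measurable]: "B \<in> sets N" by simp
      \<comment> \<open>Invertibility writes \<open>B\<close> as a preimage under \<open>S\<close>,
        so that the density composed with \<open>S\<close> can be compared with \<open>f\<close>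
        through the invariance of \<open>\<nu>\<close>.\<close>
      define C where "C = inv S -` B"
      have C [measurable]: "C \<in> sets N"
        using measurable_sets[OF S' B] by (simp add: C_def space)
      have BC: "B = S -` C"
        using bij by (auto simp: C_def inv_f_f bij_is_inj)
      have ind: "indicator B y = indicator C (S y)" for y by (simp add: BC indicator_def)
      have "emeasure (density N (\<lambda>y. f (S y))) B = (\<integral>\<^sup>+y. f (S y) * indicator C (S y) \<partial>N)"
        by (simp add: emeasure_density ind)
      also have "\<dots> = (\<integral>\<^sup>+y. f y * indicator C y \<partial>distr N N S)"
        by (subst nn_integral_distr) auto
      also have "\<dots> = emeasure \<nu> C"
        unfolding SN by (simp add: \<nu>[symmetric] emeasure_density)
      also have "\<dots> = emeasure \<nu> B" using inv[OF C] BC by simp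
      finally show "emeasure (density N (\<lambda>y. f (S y))) B = emeasure (density N f) B"
        by (simp add: \<nu>)
    qed simp
  qed auto
  then have step: "AE y in N. f ((S ^^ Suc m) y) = f ((S ^^ m) y)" for m
    using AE_distrD[of "S ^^ m" N N "\<lambda>y. f (S y) = f y", unfolded distr_funpow[OF \<open>S \<in> N \<rightarrow>\<^sub>M N\<close> SN]]
    by simp
  \<comment> \<open>Ergodicity speaks of sets that are exactly invariant, but \<open>f\<close> is
    invariant only almost everywhere. The upper limit along orbits is invariant at every point and
    still agrees with \<open>f\<close> almost everywhere.\<close>
  define g where "g y = limsup (\<lambda>m. f ((S ^^ m) y))" for y
  have g [measurable]: "g \<in> borel_measurable N" unfolding g_def by measurable
  have g_inv: "g (S y) = g y" for y
    unfolding g_def using limsup_shift[of "\<lambda>m. f ((S ^^ m) y)"] by (simp add: funpow_swap1)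
  have gf: "AE y in N. g y = f y"
  proof -
    have "AE y in N. \<forall>m. f ((S ^^ Suc m) y) = f ((S ^^ m) y)"
      using step by (simp only: AE_all_countable) blast
    then show ?thesis
    proof eventually_elim
      case (elim y)
      have "f ((S ^^ m) y) = f y" for m by (induction m) (use elim in auto)
      then show ?case by (simp add: g_def Limsup_const)
    qed
  qed
  define \<alpha> where "\<alpha> = emeasure \<nu> UNIV"
  have \<alpha>: "(\<integral>\<^sup>+y. g y \<partial>N) = \<alpha>"
  proof -
    have "(\<integral>\<^sup>+y. g y \<partial>N) = (\<integral>\<^sup>+y. f y \<partial>N)" using gf by (rule nn_integral_cong_AE)
    also have "\<dots> = \<alpha>"
      using emeasure_density[of f N UNIV] sets.top[of N] by (simp add: \<alpha>_def \<nu> space)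
    finally show ?thesis .
  qed
  have const: "(\<integral>\<^sup>+y. \<alpha> \<partial>N) = \<alpha>" by (simp add: N.emeasure_space_1)
  \<comment> \<open>As \<open>N\<close> is a probability measure, \<open>\<alpha>\<close> is the
    mean of \<open>g\<close>. A function cannot exceed its finite mean almost everywhere, so
    \<open>A\<close> is not of measure 1.\<close>
  define A where "A = {y. g y > \<alpha>}"
  have A [measurable]: "A \<in> sets N"
    using measurable_sets[OF g, of "{\<alpha><..}"] by (simp add: A_def space vimage_def)
  have "S -` A = A" by (auto simp: A_def g_inv)
  then have "measure N A = 0 \<or> measure N A = 1"
    using erg by (simp add: ergodic_system_def)
  then have le: "AE y in N. g y \<le> \<alpha>"
  proof
    assume "measure N A = 0"
    then have "AE y in N. y \<notin> A" by (intro AE_not_in) (auto simp: null_sets_def N.emeasure_eq_measure)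
    then show ?thesis by eventually_elim (simp add: A_def not_less)
  next
    assume "measure N A = 1"
    then have ae: "AE y in N. \<alpha> < g y"
      using N.prob_eq_1[OF A] by (simp add: A_def)
    have "(\<integral>\<^sup>+y. \<alpha> \<partial>N) < (\<integral>\<^sup>+y. g y \<partial>N)"
    proof (rule nn_integral_less)
      show "(\<integral>\<^sup>+y. \<alpha> \<partial>N) \<noteq> \<infinity>" using const fin by (simp add: \<alpha>_def)
      show "AE y in N. \<alpha> \<le> g y" using ae by eventually_elim simp
      show "\<not> (AE y in N. g y \<le> \<alpha>)"
      proof
        assume "AE y in N. g y \<le> \<alpha>"
        with ae have "AE y in N. False" by eventually_elim simp
        then show False by simp
      qed
    qed auto
    then show ?thesis by (simp only: const \<alpha> less_irrefl)
  qed
  have "AE y in N. \<alpha> \<le> g y"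
  proof (rule ccontr)
    assume "\<not> (AE y in N. \<alpha> \<le> g y)"
    then have "(\<integral>\<^sup>+y. g y \<partial>N) < (\<integral>\<^sup>+y. \<alpha> \<partial>N)"
      using le fin \<alpha> by (intro nn_integral_less) (auto simp: \<alpha>_def)
    then show False by (simp only: const \<alpha> less_irrefl)
  qed
  with le gf have "AE y in N. f y = \<alpha>" by eventually_elim auto
  then have "(\<integral>\<^sup>+y. f y * indicator B y \<partial>N) = (\<integral>\<^sup>+y. \<alpha> * indicator B y \<partial>N)"
    by (intro nn_integral_cong_AE) auto
  then show ?thesis using B
    by (simp add: \<nu>[symmetric] emeasure_density \<alpha>_def nn_integral_cmult_indicator)
qed

section \<open>Correlations in a joining with an ergodic system\<close>

locale ergodic_joining =
  fixes M :: "'x::compact_metric_space measure" and T and N :: "'z::compact_metric_space measure"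
    and S and J
  assumes setsM: "sets M = sets borel" and probM: "prob_space M" and T [measurable]: "T \<in> M \<rightarrow>\<^sub>M M"
    and erg: "ergodic_system N S" and J: "joining M T N S J"
begin

sublocale M: prob_space M by (rule probM)

lemma setsN: "sets N = sets borel" and probN: "prob_space N" and S [measurable]: "S \<in> N \<rightarrow>\<^sub>M N"
  and SN: "distr N N S = N"
  using erg by (auto simp: ergodic_system_def measure_preserving_system_def)

sublocale N: prob_space N by (rule probN)

lemma spaceM: "space M = UNIV" and spaceN: "space N = UNIV"
  using sets_eq_imp_space_eq[OF setsM] sets_eq_imp_space_eq[OF setsN] by auto

lemma setsJ [measurable_cong]: "sets J = sets (M \<Otimes>\<^sub>M N)"
  and J_inv: "distr J J (map_prod T S) = J" and J_fst: "distr J M fst = M" and J_snd: "distr J N snd = N"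
  using J by (auto simp: joining_def)

lemma measurable_R [measurable]: "map_prod T S \<in> J \<rightarrow>\<^sub>M J"
  unfolding map_prod_def by measurable

sublocale J: prob_space J
proof (rule prob_space_distrD[of fst J M])
  show "prob_space (distr J M fst)" unfolding J_fst by (rule probM)
qed measurable

lemma AE_fst:
  assumes "AE x in M. P x"
  shows "AE z in J. P (fst z)"
  using AE_distrD[of fst J M P, unfolded J_fst] assms by simp

lemma integral_fst':
  fixes F :: "'x \<Rightarrow> 'b::{banach, second_countable_topology}"
  assumes [measurable]: "F \<in> borel_measurable M"
  shows "(\<integral>z. F (fst z) \<partial>J) = (\<integral>x. F x \<partial>M)"
  using integral_distr[of fst J M F] by (simp add: J_fst)

text \<open>The projection \<open>fst\<close> intertwines the product map with \<open>T\<close>, so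
  the invariance of \<open>J\<close> descends to its marginal.\<close>

lemma T_inv: "distr M M T = M"
proof -
  have "distr M M T = distr (distr J M fst) M T" by (simp add: J_fst)
  also have "\<dots> = distr J M (T \<circ> fst)" by (rule distr_distr) auto
  also have "T \<circ> fst = fst \<circ> map_prod T S" by auto
  also have "distr J M \<dots> = distr (distr J J (map_prod T S)) M fst"
    by (rule distr_distr[symmetric]) auto
  finally show ?thesis by (simp add: J_inv J_fst)
qed

lemma AE_T:
  assumes "AE x in M. P x"
  shows "AE x in M. P (T x)"
  using AE_distrD[of T M M P, unfolded T_inv] assms by simp

text \<open>Weighting \<open>J\<close> by the invariant \<open>F\<close> and projecting to the
  second factor gives an \<open>S\<close>-invariant measure that is absolutely continuous with
  respect to \<open>N\<close>, hence a multiple of \<open>N\<close>.\<close>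

lemma invariant_independent_real:
  fixes F :: "'x \<Rightarrow> real"
  assumes F [measurable]: "F \<in> borel_measurable M" and pos: "\<And>x. 0 \<le> F x" and bound: "\<And>x. F x \<le> C"
    and inv: "AE x in M. F (T x) = F x" and B [measurable]: "B \<in> sets N"
  shows "(\<integral>z. F (fst z) * indicator B (snd z) \<partial>J) = (\<integral>x. F x \<partial>M) * measure N B"
proof -
  define \<nu> where "\<nu> = distr (density J (\<lambda>z. ennreal (F (fst z)))) N snd"
  have em: "emeasure \<nu> B = (\<integral>\<^sup>+z. ennreal (F (fst z) * indicator B (snd z)) \<partial>J)" if [measurable]: "B \<in> sets N" for B
  proof -
    have "emeasure \<nu> B = emeasure (density J (\<lambda>z. ennreal (F (fst z)))) (snd -` B \<inter> space J)"
      unfolding \<nu>_def by (subst emeasure_distr) auto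
    also have "\<dots> = (\<integral>\<^sup>+z. ennreal (F (fst z)) * indicator (snd -` B \<inter> space J) z \<partial>J)"
      by (subst emeasure_density) auto
    also have "\<dots> = (\<integral>\<^sup>+z. ennreal (F (fst z) * indicator B (snd z)) \<partial>J)"
      by (rule nn_integral_cong) (auto simp: indicator_def)
    finally show ?thesis .
  qed
  have int: "integrable J (\<lambda>z. F (fst z) * indicator B (snd z))" if [measurable]: "B \<in> sets N" for B
    by (rule J.integrable_const_bound[of _ C])
      (use pos bound order_trans[OF pos bound] in \<open>auto simp: indicator_def\<close>)
  have em': "emeasure \<nu> B = ennreal (\<integral>z. F (fst z) * indicator B (snd z) \<partial>J)" if "B \<in> sets N" for B
    unfolding em[OF that] using int[OF that] pos by (intro nn_integral_eq_integral) auto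
  have U: "UNIV \<in> sets N" using sets.top[of N] by (simp add: spaceN)
  have "emeasure \<nu> B = emeasure \<nu> UNIV * emeasure N B"
  proof (rule ergodic_absolutely_continuous_invariant[OF erg])
    show "sets \<nu> = sets N" by (simp add: \<nu>_def)
    show "emeasure \<nu> UNIV \<noteq> \<infinity>" using em'[OF U] by simp
    show "absolutely_continuous N \<nu>"
      unfolding absolutely_continuous_def
    proof
      fix B assume "B \<in> null_sets N"
      then have B [measurable]: "B \<in> sets N" and "AE y in N. y \<notin> B" by (auto dest: AE_not_in)
      then have "AE z in J. snd z \<notin> B"
        using AE_distrD[of snd J N "\<lambda>y. y \<notin> B", unfolded J_snd] by simp
      then have "emeasure \<nu> B = 0"
        unfolding em[OF B] by (subst nn_integral_0_iff_AE) (auto elim!: eventually_mono)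
      then show "B \<in> null_sets \<nu>" using B by (auto simp: null_sets_def \<nu>_def)
    qed
    show "emeasure \<nu> (S -` B) = emeasure \<nu> B" if B [measurable]: "B \<in> sets N" for B
    proof -
      have SB: "S -` B \<in> sets N" using measurable_sets[OF S B] by (simp add: spaceN)
      have "emeasure \<nu> (S -` B) = (\<integral>\<^sup>+z. ennreal (F (fst z) * indicator B (S (snd z))) \<partial>J)"
        unfolding em[OF SB] by (rule nn_integral_cong) (simp add: indicator_def)
      also have "\<dots> = (\<integral>\<^sup>+z. ennreal (F (T (fst z)) * indicator B (S (snd z))) \<partial>J)"
        using AE_fst[OF inv] by (intro nn_integral_cong_AE) (auto elim!: eventually_mono)
      also have "\<dots> = (\<integral>\<^sup>+z. ennreal (F (fst z) * indicator B (snd z)) \<partial>distr J J (map_prod T S))"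
        by (subst nn_integral_distr) auto
      finally show ?thesis by (simp add: J_inv em)
    qed
  qed (rule B)
  moreover have "(\<integral>z. F (fst z) * indicator UNIV (snd z) \<partial>J) = (\<integral>x. F x \<partial>M)"
    using integral_fst'[OF F] by simp
  ultimately have "ennreal (\<integral>z. F (fst z) * indicator B (snd z) \<partial>J) = ennreal ((\<integral>x. F x \<partial>M) * measure N B)"
    unfolding em'[OF B] em'[OF U] using pos
    by (simp add: N.emeasure_eq_measure ennreal_mult')
  then show ?thesis
    using pos by (subst (asm) ennreal_inj) (auto intro!: integral_nonneg_AE mult_nonneg_nonneg)
qed

text \<open>On the side of the ergodic factor indicators suffice, because a joining is determined by
  its values on rectangles.\<close>

definition corr :: "('x \<Rightarrow> complex) \<Rightarrow> 'z set \<Rightarrow> complex" where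
  "corr F B = (\<integral>z. F (fst z) * indicator B (snd z) \<partial>J)"

lemma corr_cong_AE:
  assumes "AE x in M. F x = G x"
    and [measurable]: "F \<in> borel_measurable M" "G \<in> borel_measurable M" "B \<in> sets N"
  shows "corr F B = corr G B"
  unfolding corr_def using AE_fst[OF assms(1)] by (intro integral_cong_AE) (auto elim!: eventually_mono)

lemma corr_UNIV: "F \<in> borel_measurable M \<Longrightarrow> corr F UNIV = (\<integral>x. F x \<partial>M)"
  by (simp add: corr_def integral_fst')

lemma corr_invariant:
  assumes F [measurable]: "F \<in> borel_measurable M" and bound: "\<And>x. norm (F x) \<le> 1"
    and inv: "AE x in M. F (T x) = F x" and B [measurable]: "B \<in> sets N"
  shows "corr F B = (\<integral>x. F x \<partial>M) * measure N B"
proof -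
  have intF: "integrable M F" by (rule M.integrable_const_bound[of _ 1]) (use bound in auto)
  have intJ: "integrable J (\<lambda>z. F (fst z) * indicator B (snd z))"
    by (rule J.integrable_const_bound[of _ 1]) (use bound in \<open>auto simp: indicator_def norm_mult\<close>)
  have B_int: "(\<integral>z. indicator B (snd z) \<partial>J) = measure N B"
    using integral_distr[of snd J N "indicator B :: _ \<Rightarrow> real"] by (simp add: J_snd spaceN)
  have main: "(\<integral>z. G (fst z) * indicator B (snd z) \<partial>J) = (\<integral>x. G x \<partial>M) * measure N B"
    if G [measurable]: "G \<in> borel_measurable M" and G_bound: "\<And>x. \<bar>G x\<bar> \<le> 1"
      and G_inv: "AE x in M. G (T x) = G x" for G :: "'x \<Rightarrow> real"
  proof -
    \<comment> \<open>Adding 1 makes the function non-negative, and the surplus integrates to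
      \<open>measure N B\<close> on both sides.\<close>
    have "(\<integral>z. (G (fst z) + 1) * indicator B (snd z) \<partial>J) = (\<integral>x. G x + 1 \<partial>M) * measure N B"
    proof (rule invariant_independent_real[where C = 2])
      show "0 \<le> G x + 1" "G x + 1 \<le> 2" for x using G_bound[of x] by (auto simp: abs_le_iff)
    qed (use G_inv in auto)
    moreover have "integrable M G"
      by (rule M.integrable_const_bound[of _ 1]) (use G_bound in auto)
    moreover have "integrable J (\<lambda>z. G (fst z) * indicator B (snd z))"
      by (rule J.integrable_const_bound[of _ 1]) (use G_bound in \<open>auto simp: indicator_def\<close>)
    moreover have "integrable J (\<lambda>z. indicator B (snd z) :: real)"
      by (rule J.integrable_const_bound[of _ 1]) (auto simp: indicator_def)
    ultimately show ?thesis
      by (simp add: distrib_right B_int M.prob_space)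
  qed
  have "(\<integral>z. Re (F (fst z)) * indicator B (snd z) \<partial>J) = (\<integral>x. Re (F x) \<partial>M) * measure N B"
    using inv by (intro main) (auto intro: order_trans[OF abs_Re_le_cmod bound] elim!: eventually_mono)
  moreover have "(\<integral>z. Im (F (fst z)) * indicator B (snd z) \<partial>J) = (\<integral>x. Im (F x) \<partial>M) * measure N B"
    using inv by (intro main) (auto intro: order_trans[OF abs_Im_le_cmod bound] elim!: eventually_mono)
  moreover have "Re (corr F B) = (\<integral>z. Re (F (fst z)) * indicator B (snd z) \<partial>J)"
    "Im (corr F B) = (\<integral>z. Im (F (fst z)) * indicator B (snd z) \<partial>J)"
  proof -
    have eqs: "Re (F (fst z) * indicator B (snd z)) = Re (F (fst z)) * indicator B (snd z)"
    "Im (F (fst z) * indicator B (snd z)) = Im (F (fst z)) * indicator B (snd z)" for z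
      by (auto simp: indicator_def)
    show "Re (corr F B) = (\<integral>z. Re (F (fst z)) * indicator B (snd z) \<partial>J)"
      "Im (corr F B) = (\<integral>z. Im (F (fst z)) * indicator B (snd z) \<partial>J)"
      unfolding corr_def integral_Re[OF intJ, symmetric] integral_Im[OF intJ, symmetric] eqs
      by (rule refl)+
  qed
  moreover have "(\<integral>x. Re (F x) \<partial>M) = Re (\<integral>x. F x \<partial>M)" "(\<integral>x. Im (F x) \<partial>M) = Im (\<integral>x. F x \<partial>M)"
    using integral_Re[OF intF] integral_Im[OF intF] .
  ultimately show ?thesis by (intro complex_eqI) simp_all
qed

lemma funpow_map_prod: "((map_prod T S) ^^ h) z = ((T ^^ h) (fst z), (S ^^ h) (snd z))"
  by (induction h) (auto simp: map_prod_def split: prod.splits)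

text \<open>Van der Corput's trick for \<open>F\<close> times the indicator of \<open>B\<close>: the
  indicator multiplied by its translate is again an indicator, so the correlation at lag
  \<open>h\<close> is again of the form \<open>corr\<close>.\<close>

lemma corr_eq_0:
  assumes F [measurable]: "F \<in> borel_measurable M" and bound: "\<And>x. norm (F x) \<le> 1"
    and B [measurable]: "B \<in> sets N" and \<epsilon>: "\<epsilon> \<longlonglongrightarrow> (0::real)"
    and le: "\<And>h. h > 0 \<Longrightarrow>
      norm (corr (\<lambda>x. F ((T ^^ h) x) * cnj (F x)) ((S ^^ h) -` B \<inter> B)) \<le> \<epsilon> h"
  shows "corr F B = 0"
  unfolding corr_def
proof (rule van_der_Corput[OF _ measurable_R J_inv _ _ \<epsilon>])
  fix h :: nat assume "h > 0"
  have "(\<integral>z. F (fst ((map_prod T S ^^ h) z)) * indicator B (snd ((map_prod T S ^^ h) z)) *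
      cnj (F (fst z) * indicator B (snd z)) \<partial>J) =
      corr (\<lambda>x. F ((T ^^ h) x) * cnj (F x)) ((S ^^ h) -` B \<inter> B)"
    unfolding corr_def
    by (rule Bochner_Integration.integral_cong) (auto simp: funpow_map_prod indicator_def)
  with le[OF \<open>h > 0\<close>] show "norm (\<integral>z. F (fst ((map_prod T S ^^ h) z)) *
      indicator B (snd ((map_prod T S ^^ h) z)) * cnj (F (fst z) * indicator B (snd z)) \<partial>J) \<le> \<epsilon> h"
    by (simp only:)
qed (use bound J.prob_space_axioms in \<open>auto simp: indicator_def norm_mult\<close>)

end

section \<open>Unipotent factors\<close>

lemma finite_measure_eqI_continuous:
  fixes M1 M2 :: "'a::metric_space measure"
  assumes fin: "finite_measure M1" "finite_measure M2"
    and sets: "sets M1 = sets borel" "sets M2 = sets borel"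
    and eq: "\<And>f :: 'a \<Rightarrow> real. continuous_on UNIV f \<Longrightarrow> (\<integral>x. f x \<partial>M1) = (\<integral>x. f x \<partial>M2)"
  shows "M1 = M2"
proof (rule measure_eqI_generator_eq[where E = "Collect closed" and \<Omega> = UNIV and A = "\<lambda>_. UNIV"])
  show "emeasure M1 A = emeasure M2 A" if "A \<in> Collect closed" for A
  \<comment> \<open>By convention \<open>infdist x {}\<close> is 0, so the functions below would not
    converge to the indicator of the empty set.\<close>
  proof (cases "A = {}")
    case False
    have A: "closed A" using that by simp
    \<comment> \<open>These tent functions decrease to the indicator of the closed set
      \<open>A\<close>, and closed sets form an intersection-stable generator of the Borel
      sets.\<close>
    define f where "f n x = max 0 (1 - real n * infdist x A)" for n x
    have cont: "continuous_on UNIV (f n)" for n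
      unfolding f_def by (intro continuous_intros)
    have lim: "(\<lambda>n. \<integral>x. f n x \<partial>M) \<longlonglongrightarrow> measure M A"
      if "finite_measure M" and sets: "sets M = sets borel" for M
    proof -
      interpret finite_measure M by fact
      have [measurable]: "f n \<in> borel_measurable M" for n
        using borel_measurable_continuous_onI[OF cont] sets by (simp cong: measurable_cong_sets)
      have [measurable]: "A \<in> sets M" using A sets by simp
      have "(\<lambda>n. \<integral>x. f n x \<partial>M) \<longlonglongrightarrow> (\<integral>x. indicator A x \<partial>M)"
      proof (rule integral_dominated_convergence[where w = "\<lambda>_. 1"])
        show "AE x in M. (\<lambda>n. f n x) \<longlonglongrightarrow> indicator A x"
        proof (rule AE_I2)
          fix x
          show "(\<lambda>n. f n x) \<longlonglongrightarrow> indicator A x"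
          proof (cases "x \<in> A")
            case False
            then have pos: "infdist x A > 0"
              using in_closed_iff_infdist_zero[OF A \<open>A \<noteq> {}\<close>, of x] infdist_nonneg[of x A] by simp
            have "\<forall>\<^sub>F n in sequentially. f n x = 0"
            proof -
              obtain n0 :: nat where n0: "1 / infdist x A \<le> real n0" using real_arch_simple by blast
              have "f n x = 0" if "n \<ge> n0" for n
              proof -
                have "1 / infdist x A \<le> real n" using n0 that by linarith
                then show ?thesis using pos by (simp add: f_def field_simps)
              qed
              then show ?thesis by (auto simp: eventually_sequentially)
            qed
            then show ?thesis using False by (simp add: tendsto_eventually)
          qed (simp add: f_def)
        qed
        show "AE x in M. norm (f n x) \<le> 1" for n
          by (rule AE_I2) (simp add: f_def infdist_nonneg)
      qed auto
      then show ?thesis using sets_eq_imp_space_eq[OF sets] by simp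
    qed
    have "measure M1 A = measure M2 A"
      using lim[OF fin(1) sets(1)] lim[OF fin(2) sets(2)] eq[OF cont]
      by (auto intro: LIMSEQ_unique)
    then show ?thesis using fin by (simp add: finite_measure.emeasure_eq_measure)
  qed simp
  show "sets M1 = sigma_sets UNIV (Collect closed)" "sets M2 = sigma_sets UNIV (Collect closed)"
    unfolding sets borel_eq_closed by auto
  show "emeasure M1 UNIV \<noteq> \<infinity>" using fin(1) by (simp add: finite_measure.emeasure_eq_measure)
qed (auto simp: Int_stable_def)

text \<open>Since \<open>c\<close> is an arbitrary complex number, this covers real and imaginary
  parts and their real multiples: the real algebra to which the Stone-Weierstrass theorem is
  applied.\<close>

inductive_set re_span :: "('a \<Rightarrow> complex) set \<Rightarrow> ('a \<Rightarrow> real) set" for \<C> where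
  base: "F \<in> \<C> \<Longrightarrow> (\<lambda>x. Re (c * F x)) \<in> re_span \<C>"
| add: "f \<in> re_span \<C> \<Longrightarrow> g \<in> re_span \<C> \<Longrightarrow> (\<lambda>x. f x + g x) \<in> re_span \<C>"

text \<open>Products are linearised by
  \<open>Re z * Re w = Re (z * w / 2) + Re (z * cnj w / 2)\<close>.\<close>

lemma re_span_mult:
  assumes mult: "\<And>F G. F \<in> \<C> \<Longrightarrow> G \<in> \<C> \<Longrightarrow> (\<lambda>x. F x * G x) \<in> \<C>"
    and cnj: "\<And>F. F \<in> \<C> \<Longrightarrow> (\<lambda>x. cnj (F x)) \<in> \<C>"
    and f: "f \<in> re_span \<C>" and g: "g \<in> re_span \<C>"
  shows "(\<lambda>x. f x * g x) \<in> re_span \<C>"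
  using f
proof induction
  case (base F c)
  show ?case using g
  proof induction
    case (base G c')
    have "(\<lambda>x. Re (c * F x) * Re (c' * G x)) =
      (\<lambda>x. Re ((c * c' / 2) * (F x * G x)) + Re ((c * cnj c' / 2) * (F x * cnj (G x))))"
    proof
      fix x
      have "Re z * Re w = Re (z * w / 2) + Re (z * cnj w / 2)" for z w
        by (simp add: field_simps)
      from this[of "c * F x" "c' * G x"]
      show "Re (c * F x) * Re (c' * G x) =
          Re ((c * c' / 2) * (F x * G x)) + Re ((c * cnj c' / 2) * (F x * cnj (G x)))"
        by (simp only: complex_cnj_mult times_divide_eq_left times_divide_eq_right mult_ac)
    qed
    moreover have "\<dots> \<in> re_span \<C>"
      using \<open>F \<in> \<C>\<close> base by (intro re_span.intros mult cnj)
    ultimately show ?case by simp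
  next
    case (add g1 g2)
    then show ?case using re_span.add by (fastforce simp: distrib_left)
  qed
next
  case (add f1 f2)
  then show ?case using re_span.add by (fastforce simp: distrib_right)
qed

lemma function_ring_on_re_span:
  fixes \<C> :: "('a::compact_metric_space \<Rightarrow> complex) set"
  assumes cont: "\<And>F. F \<in> \<C> \<Longrightarrow> continuous_on UNIV F"
    and one: "(\<lambda>_. 1) \<in> \<C>"
    and mult: "\<And>F G. F \<in> \<C> \<Longrightarrow> G \<in> \<C> \<Longrightarrow> (\<lambda>x. F x * G x) \<in> \<C>"
    and cnj: "\<And>F. F \<in> \<C> \<Longrightarrow> (\<lambda>x. cnj (F x)) \<in> \<C>"
    and sep: "\<And>x y. x \<noteq> y \<Longrightarrow> \<exists>F\<in>\<C>. F x \<noteq> F y"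
  shows "function_ring_on (re_span \<C>) UNIV"
proof
  show "compact (UNIV :: 'a set)" by (rule compact_UNIV_metric)
  show "continuous_on UNIV f" if "f \<in> re_span \<C>" for f
    using that by induction (auto intro!: continuous_intros cont)
  show "(\<lambda>_. c) \<in> re_span \<C>" for c
    using re_span.base[OF one, of "of_real c"] by simp
  show "\<exists>f\<in>re_span \<C>. f x \<noteq> f y" if xy: "x \<noteq> y" for x y
  proof -
    obtain F where F: "F \<in> \<C>" "F x \<noteq> F y" using sep[OF xy] by blast
    then have "Re (1 * F x) \<noteq> Re (1 * F y) \<or> Re (- \<i> * F x) \<noteq> Re (- \<i> * F y)"
      by (auto simp: complex_eq_iff)
    then show ?thesis
      using re_span.base[OF F(1), of 1] re_span.base[OF F(1), of "- \<i>"] by (elim disjE) (rule bexI, assumption+)+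
  qed
  show "(\<lambda>x. f x + g x) \<in> re_span \<C>" if "f \<in> re_span \<C>" "g \<in> re_span \<C>" for f g
    using that by (rule re_span.add)
  show "(\<lambda>x. f x * g x) \<in> re_span \<C>" if "f \<in> re_span \<C>" "g \<in> re_span \<C>" for f g
    using mult cnj that by (rule re_span_mult)
qed

lemma continuous_on_UNIV_bounded:
  fixes f :: "'a::compact_metric_space \<Rightarrow> 'b::real_normed_vector"
  assumes "continuous_on UNIV f"
  obtains C where "\<And>x. norm (f x) \<le> C"
proof -
  have "compact (range f)" using assms compact_UNIV_metric by (rule compact_continuous_image)
  then show thesis using that compact_imp_bounded bounded_iff by (metis rangeI)
qed

context ergodic_joining
begin

lemma borel_measurable_continuous:
  fixes F :: "'x \<Rightarrow> 'b::topological_space"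
  shows "continuous_on UNIV F \<Longrightarrow> F \<in> borel_measurable M"
  using borel_measurable_continuous_onI[of F] setsM by (simp cong: measurable_cong_sets)

text \<open>Independence passes from \<open>\<C>\<close> to its span by linearity, to all continuous
  functions by uniform approximation, and to Borel sets because continuous functions determine
  finite measures.\<close>

lemma eq_pair_measure_if_corr:
  assumes cont: "\<And>F. F \<in> \<C> \<Longrightarrow> continuous_on UNIV F"
    and one: "(\<lambda>_. 1) \<in> \<C>"
    and mult: "\<And>F G. F \<in> \<C> \<Longrightarrow> G \<in> \<C> \<Longrightarrow> (\<lambda>x. F x * G x) \<in> \<C>"
    and cnj: "\<And>F. F \<in> \<C> \<Longrightarrow> (\<lambda>x. cnj (F x)) \<in> \<C>"
    and sep: "\<And>x y. x \<noteq> y \<Longrightarrow> \<exists>F\<in>\<C>. F x \<noteq> F y"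
    and corr: "\<And>F B. F \<in> \<C> \<Longrightarrow> B \<in> sets N \<Longrightarrow> corr F B = (\<integral>x. F x \<partial>M) * measure N B"
  shows "J = M \<Otimes>\<^sub>M N"
proof -
  interpret R: function_ring_on "re_span \<C>" UNIV
    using assms(1-5) by (rule function_ring_on_re_span)
  have intM: "integrable M f" if f: "continuous_on UNIV f" for f :: "'x \<Rightarrow> real"
  proof -
    obtain C where "\<And>x. norm (f x) \<le> C" using continuous_on_UNIV_bounded[OF f] by blast
    then show ?thesis
      using borel_measurable_continuous[OF f] by (intro M.integrable_const_bound[of _ C]) auto
  qed
  have intJ: "integrable J (\<lambda>z. f (fst z) * indicator B (snd z))"
    if f: "continuous_on UNIV f" and [measurable]: "B \<in> sets N" for f :: "'x \<Rightarrow> real" and B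
  proof -
    have [measurable]: "f \<in> borel_measurable M" using f by (rule borel_measurable_continuous)
    obtain C where C: "\<And>x. norm (f x) \<le> C" using continuous_on_UNIV_bounded[OF f] by blast
    have "0 \<le> C" using C[of undefined] norm_ge_zero order_trans by blast
    with C show ?thesis
      by (intro J.integrable_const_bound[of _ C]) (auto simp: indicator_def)
  qed
  have span: "(\<integral>z. f (fst z) * indicator B (snd z) \<partial>J) = (\<integral>x. f x \<partial>M) * measure N B"
    if "f \<in> re_span \<C>" and B [measurable]: "B \<in> sets N" for f B
    using that(1)
  proof induction
    case (base F c)
    have [measurable]: "F \<in> borel_measurable M" using cont[OF base] by (rule borel_measurable_continuous)
    obtain C where C: "\<And>x. norm (F x) \<le> C" using continuous_on_UNIV_bounded[OF cont[OF base]] by blast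
    have "0 \<le> C" using C[of undefined] norm_ge_zero order_trans by blast
    have i1: "integrable M F" using C by (intro M.integrable_const_bound[of _ C]) auto
    have i2: "integrable J (\<lambda>z. F (fst z) * indicator B (snd z))"
      using C \<open>0 \<le> C\<close> by (intro J.integrable_const_bound[of _ C]) (auto simp: indicator_def norm_mult)
    have "(\<integral>z. Re (c * F (fst z)) * indicator B (snd z) \<partial>J) =
        (\<integral>z. Re (c * (F (fst z) * indicator B (snd z))) \<partial>J)"
      by (rule Bochner_Integration.integral_cong) (auto simp: indicator_def)
    also have "\<dots> = Re (\<integral>z. c * (F (fst z) * indicator B (snd z)) \<partial>J)"
      using i2 by (intro integral_Re integrable_mult_right) auto
    also have "\<dots> = Re (c * corr F B)" unfolding corr_def using i2 by simp
    also have "\<dots> = Re (c * (\<integral>x. F x \<partial>M)) * measure N B"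
      unfolding corr[OF base B] by (simp add: algebra_simps)
    also have "c * (\<integral>x. F x \<partial>M) = (\<integral>x. c * F x \<partial>M)" using i1 by simp
    also have "Re \<dots> = (\<integral>x. Re (c * F x) \<partial>M)"
      using i1 by (intro integral_Re[symmetric] integrable_mult_right) auto
    finally show ?case .
  next
    case (add f g)
    have "continuous_on UNIV f" "continuous_on UNIV g" using add R.continuous by auto
    then show ?case using add.IH intM intJ[OF _ B] by (simp add: distrib_right)
  qed
  have all: "(\<integral>z. f (fst z) * indicator B (snd z) \<partial>J) = (\<integral>x. f x \<partial>M) * measure N B"
    if f: "continuous_on UNIV f" and B [measurable]: "B \<in> sets N" for f :: "'x \<Rightarrow> real" and B
  proof -
    \<comment> \<open>\<open>L\<close> measures the failure of independence. It vanishes on the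
      span, and each of its two terms contributes at most \<open>e / 2\<close> for the difference of
      \<open>f\<close> and its approximation.\<close>
    define L where "L f = (\<integral>z. f (fst z) * indicator B (snd z) \<partial>J) - (\<integral>x. f x \<partial>M) * measure N B" for f
    have "\<bar>L f\<bar> \<le> e" if e: "e > 0" for e
    proof -
      obtain g where g: "g \<in> re_span \<C>" "\<And>x. \<bar>f x - g x\<bar> < e / 2"
        using R.Stone_Weierstrass_basic[OF f half_gt_zero[OF e]] by auto
      have gc: "continuous_on UNIV g" using g(1) by (rule R.continuous)
      have "L f = L f - L g" using span[OF g(1) B] by (simp add: L_def)
      also have "\<dots> = (\<integral>z. (f (fst z) - g (fst z)) * indicator B (snd z) \<partial>J) -
          (\<integral>x. f x - g x \<partial>M) * measure N B"
        using intM[OF f] intM[OF gc] intJ[OF f B] intJ[OF gc B]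
        by (simp add: L_def left_diff_distrib)
      finally have "\<bar>L f\<bar> \<le> \<bar>\<integral>z. (f (fst z) - g (fst z)) * indicator B (snd z) \<partial>J\<bar> +
          \<bar>\<integral>x. f x - g x \<partial>M\<bar> * measure N B"
        using abs_triangle_ineq4 abs_mult[of _ "measure N B"] abs_of_nonneg[OF measure_nonneg[of N B]]
        by metis
      moreover have "\<bar>\<integral>z. (f (fst z) - g (fst z)) * indicator B (snd z) \<partial>J\<bar> \<le> e / 2"
      proof -
        have [measurable]: "f \<in> borel_measurable M" "g \<in> borel_measurable M"
          using f gc by (auto intro: borel_measurable_continuous)
        have b: "\<bar>(f (fst z) - g (fst z)) * indicator B (snd z)\<bar> \<le> e / 2" for z
          using g(2)[of "fst z"] e by (auto simp: indicator_def)
        have "\<bar>\<integral>z. (f (fst z) - g (fst z)) * indicator B (snd z) \<partial>J\<bar> \<le>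
            (\<integral>z. \<bar>(f (fst z) - g (fst z)) * indicator B (snd z)\<bar> \<partial>J)"
          by (rule integral_abs_bound)
        also have "\<dots> \<le> e / 2"
          by (rule J.integral_le_const)
            (use b in \<open>auto intro!: J.integrable_const_bound[of _ "e / 2"] simp: abs_mult\<close>)
        finally show ?thesis .
      qed
      moreover have "\<bar>\<integral>x. f x - g x \<partial>M\<bar> * measure N B \<le> e / 2 * 1"
      proof (rule mult_mono)
        have "\<bar>\<integral>x. f x - g x \<partial>M\<bar> \<le> (\<integral>x. \<bar>f x - g x\<bar> \<partial>M)" by (rule integral_abs_bound)
        also have "\<dots> \<le> e / 2"
          using intM[OF f] intM[OF gc] g(2) by (intro M.integral_le_const) (auto intro: less_imp_le)
        finally show "\<bar>\<integral>x. f x - g x \<partial>M\<bar> \<le> e / 2" .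
      qed (use e in auto)
      ultimately show ?thesis by simp
    qed
    then have "L f = 0" using field_le_epsilon[of "\<bar>L f\<bar>" 0] by simp
    then show ?thesis by (simp add: L_def)
  qed
  have "emeasure M A * emeasure N B = emeasure J (A \<times> B)"
    if A [measurable]: "A \<in> sets M" and B [measurable]: "B \<in> sets N" for A B
  proof -
    \<comment> \<open>For fixed \<open>B\<close>, \<open>M1\<close> sends \<open>A\<close> to the
      \<open>J\<close>-measure of the rectangle \<open>A \<times> B\<close>, and \<open>M2\<close>
      sends it to the product of the measures of \<open>A\<close> and \<open>B\<close>.\<close>
    define M1 where "M1 = distr (density J (\<lambda>z. ennreal (indicator B (snd z)))) M fst"
    define M2 where "M2 = density M (\<lambda>_. ennreal (measure N B))"
    have i1: "(\<integral>x. f x \<partial>M1) = (\<integral>z. f (fst z) * indicator B (snd z) \<partial>J)"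
      if "continuous_on UNIV f" for f :: "'x \<Rightarrow> real"
    proof -
      have [measurable]: "f \<in> borel_measurable M" using that by (rule borel_measurable_continuous)
      have "(\<integral>x. f x \<partial>M1) = (\<integral>z. f (fst z) \<partial>density J (\<lambda>z. ennreal (indicator B (snd z))))"
        unfolding M1_def by (rule integral_distr) auto
      also have "\<dots> = (\<integral>z. indicator B (snd z) *\<^sub>R f (fst z) \<partial>J)"
        by (rule integral_density) auto
      finally show ?thesis by (simp add: mult.commute)
    qed
    have i2: "(\<integral>x. f x \<partial>M2) = (\<integral>x. f x \<partial>M) * measure N B"
      if "continuous_on UNIV f" for f :: "'x \<Rightarrow> real"
    proof -
      have [measurable]: "f \<in> borel_measurable M" using that by (rule borel_measurable_continuous)
      have "(\<integral>x. f x \<partial>M2) = (\<integral>x. measure N B *\<^sub>R f x \<partial>M)"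
        unfolding M2_def by (rule integral_density) auto
      then show ?thesis by (simp add: mult.commute)
    qed
    have e1: "emeasure M1 A = emeasure J (A \<times> B)" if [measurable]: "A \<in> sets M" for A
    proof -
      have "emeasure M1 A = emeasure (density J (\<lambda>z. ennreal (indicator B (snd z)))) (fst -` A \<inter> space J)"
        unfolding M1_def by (subst emeasure_distr) auto
      also have "\<dots> = (\<integral>\<^sup>+z. ennreal (indicator B (snd z)) * indicator (fst -` A \<inter> space J) z \<partial>J)"
        by (subst emeasure_density) auto
      also have "\<dots> = (\<integral>\<^sup>+z. indicator (A \<times> B) z \<partial>J)"
        by (rule nn_integral_cong) (auto simp: indicator_def)
      also have "\<dots> = emeasure J (A \<times> B)" by (rule nn_integral_indicator) auto
      finally show ?thesis .
    qed
    have e2: "emeasure M2 A = emeasure M A * emeasure N B" if [measurable]: "A \<in> sets M" for A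
      unfolding M2_def by (simp add: emeasure_density_const N.emeasure_eq_measure mult.commute)
    have U: "UNIV \<in> sets M" using sets.top[of M] by (simp add: spaceM)
    have "M1 = M2"
    proof (rule finite_measure_eqI_continuous)
      show "finite_measure M1"
        by (rule finite_measureI) (use e1[OF U] in \<open>simp add: M1_def spaceM J.emeasure_eq_measure\<close>)
      show "finite_measure M2"
        by (rule finite_measureI)
          (use e2[OF U] in \<open>simp add: M2_def spaceM M.emeasure_eq_measure N.emeasure_eq_measure ennreal_mult[symmetric]\<close>)
      show "(\<integral>x. f x \<partial>M1) = (\<integral>x. f x \<partial>M2)" if "continuous_on UNIV f" for f :: "'x \<Rightarrow> real"
        using all[OF that B] i1[OF that] i2[OF that] by simp
    qed (auto simp: M1_def M2_def setsM)
    with e1[OF A] e2[OF A] show ?thesis by simp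
  qed
  then have "M \<Otimes>\<^sub>M N = J"
    by (intro pair_measure_eqI M.sigma_finite_measure_axioms N.sigma_finite_measure_axioms)
      (auto simp: setsJ)
  then show ?thesis ..
qed

end

section \<open>Exponent vectors of monomials and the action of \<open>T\<close> on them\<close>

definition pascal_shift :: "(nat \<Rightarrow> int) \<Rightarrow> nat \<Rightarrow> int" where
  "pascal_shift l i = l i + (if i = 0 then 0 else l (i - 1))"

text \<open>The relation is triangular, so the exponents can be solved for one after the other. This
  is what later produces monomials at negative times.\<close>

lemma pascal_shift_surj: "\<exists>l'. pascal_shift l' = l"
proof -
  define l' where "l' = rec_nat (l 0) (\<lambda>i v. l (Suc i) - v)"
  have "pascal_shift l' i = l i" for i
    by (cases i) (simp_all add: pascal_shift_def l'_def)
  then show ?thesis by blast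
qed

lemma funpow_pascal_shift_surj: "\<exists>l'. (pascal_shift ^^ m) l' = l"
proof (induction m arbitrary: l)
  case (Suc m)
  obtain l1 where "pascal_shift l1 = l" using pascal_shift_surj by blast
  moreover obtain l2 where "(pascal_shift ^^ m) l2 = l1" using Suc by blast
  ultimately show ?case by auto
qed simp

text \<open>The action is unipotent. The linear growth in \<open>h\<close> of the exponent after the
  leading one is what lets the decay of Fourier coefficients act after van der Corput's
  trick.\<close>

lemma funpow_pascal_shift_leading:
  assumes "\<And>i. i < k \<Longrightarrow> l i = 0"
  shows "(\<forall>i<k. (pascal_shift ^^ h) l i = 0) \<and> (pascal_shift ^^ h) l k = l k \<and>
    (pascal_shift ^^ h) l (Suc k) = l (Suc k) + int h * l k"
  by (induction h) (use assms in \<open>auto simp: pascal_shift_def algebra_simps\<close>)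

text \<open>Isolates what the ergodic-theoretic argument takes from the sequence: a unipotent action
  of \<open>T\<close> on the \<open>D i\<close>, degree at most \<open>d\<close>, and decaying
  Fourier coefficients of the distribution of \<open>D d\<close>.\<close>

locale unipotent_joining = ergodic_joining +
  fixes D :: "nat \<Rightarrow> 'a \<Rightarrow> complex" and d :: nat and C :: real
  assumes D_measurable [measurable]: "\<And>i. D i \<in> borel_measurable M"
    and norm_D: "\<And>i x. norm (D i x) = 1"
    and D_T: "\<And>i x. D i (T x) = D i x * D (Suc i) x"
    and D_top: "AE x in M. D (Suc d) x = 1"
    and decay: "\<And>h::int. h \<noteq> 0 \<Longrightarrow> norm (\<integral>x. D d x powi h \<partial>M) \<le> C / \<bar>h\<bar>"
begin

definition monomial :: "(nat \<Rightarrow> int) \<Rightarrow> 'a \<Rightarrow> complex" where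
  "monomial l x = (\<Prod>i\<le>d. D i x powi l i)"

lemma D_nonzero: "D i x \<noteq> 0"
  using norm_D[of i x] by auto

lemma measurable_power_int_D [measurable]: "(\<lambda>x. D i x powi k) \<in> borel_measurable M"
proof (cases "k \<ge> 0")
  case True
  then show ?thesis by (simp add: power_int_def)
next
  case False
  then show ?thesis by (simp add: power_int_def)
qed

lemma measurable_monomial [measurable]: "monomial l \<in> borel_measurable M"
  unfolding monomial_def by measurable

lemma norm_monomial: "norm (monomial l x) = 1"
  by (simp add: monomial_def prod_norm[symmetric] norm_power_int norm_D)

lemma monomial_diff: "monomial l x * cnj (monomial l' x) = monomial (\<lambda>i. l i - l' i) x"
proof -
  have "cnj (monomial l' x) = inverse (monomial l' x)"
    using complex_div_cnj[of 1 "monomial l' x"] norm_monomial[of l' x] by (simp add: inverse_eq_divide)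
  then show ?thesis
    by (simp add: monomial_def power_int_diff D_nonzero prod_dividef[symmetric] divide_inverse[symmetric]
        del: cnj_prod)
qed

lemma monomial_add: "monomial l x * monomial l' x = monomial (\<lambda>i. l i + l' i) x"
  by (simp add: monomial_def power_int_add D_nonzero prod.distrib)

lemma monomial_T: "AE x in M. monomial l (T x) = monomial (pascal_shift l) x"
  using D_top
proof eventually_elim
  case (elim x)
  \<comment> \<open>Shifting the index by one moves the exponent \<open>l (i - 1)\<close> to
    \<open>D i\<close>; the factor \<open>D (Suc d)\<close> that spills over is 1.\<close>
  define g where "g i = D i x powi (if i = 0 then 0 else l (i - 1))" for i
  have "(\<Prod>i\<le>d. D (Suc i) x powi l i) = (\<Prod>i\<le>Suc d. g i)"
    unfolding prod.atMost_Suc_shift by (simp add: g_def)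
  also have "\<dots> = (\<Prod>i\<le>d. g i)"
    using elim by (simp add: g_def)
  finally show ?case
    by (simp add: monomial_def D_T power_int_mult_distrib prod.distrib pascal_shift_def
        power_int_add D_nonzero g_def)
qed

lemma monomial_funpow_T: "AE x in M. monomial l ((T ^^ h) x) = monomial ((pascal_shift ^^ h) l) x"
proof (induction h)
  case (Suc h)
  from AE_T[OF Suc] monomial_T[of "(pascal_shift ^^ h) l"] show ?case
    by eventually_elim (simp add: funpow_swap1)
qed simp

text \<open>Surjectivity of \<open>pascal_shift\<close> writes the given monomial as another one
  composed with \<open>T ^^ m\<close>; the invariance of \<open>M\<close> then removes the
  composition from the almost sure identity.\<close>

lemma ex_monomial_if_funpow_T:
  assumes [measurable]: "G \<in> borel_measurable M" and eq: "AE x in M. G ((T ^^ m) x) = monomial l x"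
  shows "\<exists>l'. AE x in M. G x = monomial l' x"
proof -
  obtain l' where l': "(pascal_shift ^^ m) l' = l" using funpow_pascal_shift_surj by blast
  have "AE x in M. G ((T ^^ m) x) = monomial l' ((T ^^ m) x)"
    using eq monomial_funpow_T[of l' m] by eventually_elim (simp add: l')
  then have "AE x in distr M M (T ^^ m). G x = monomial l' x"
    by (subst AE_distr_iff) auto
  then show ?thesis unfolding distr_funpow[OF T T_inv] by blast
qed

lemma monomial_top:
  assumes "\<And>i. i < d \<Longrightarrow> l i = 0"
  shows "monomial l x = D d x powi l d"
proof -
  have "monomial l x = (\<Prod>i\<in>{d}. D i x powi l i)"
    unfolding monomial_def using assms by (intro prod.mono_neutral_right) auto
  then show ?thesis by simp
qed

text \<open>As \<open>D (Suc d)\<close> is 1 almost everywhere, powers of \<open>D d\<close> are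
  \<open>T\<close>-invariant almost everywhere, and invariant functions are independent of an
  ergodic factor.\<close>

lemma corr_monomial_top:
  assumes "\<And>i. i < d \<Longrightarrow> l i = 0" and B: "B \<in> sets N"
  shows "corr (monomial l) B = (\<integral>x. monomial l x \<partial>M) * measure N B"
proof (rule corr_invariant[OF _ _ _ B])
  show "AE x in M. monomial l (T x) = monomial l x"
    using D_top by eventually_elim (simp add: monomial_top[OF assms(1)] D_T)
qed (auto simp: norm_monomial)

text \<open>Induction on \<open>d - k\<close>, for all \<open>B\<close> at once because van der
  Corput's trick replaces \<open>B\<close> by its intersection with a preimage of
  \<open>B\<close>.\<close>

lemma corr_monomial_eq_0:
  assumes "k < d" "\<And>i. i < k \<Longrightarrow> l i = 0" "l k \<noteq> 0" "B \<in> sets N"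
  shows "corr (monomial l) B = 0"
  using assms
proof (induction "d - k" arbitrary: k l B)
  case 0
  then show ?case by simp
next
  case (Suc n)
  show ?case
  proof (rule corr_eq_0)
    \<comment> \<open>The absolute value keeps the bound non-negative, as is needed when the
      correlation at lag \<open>h\<close> is 0.\<close>
    show "(\<lambda>h. \<bar>C\<bar> / real h) \<longlonglongrightarrow> 0"
      using tendsto_mult_right_zero[OF lim_1_over_n, of "\<bar>C\<bar>"] by simp
    fix h :: nat assume h: "h > 0"
    define l' where "l' i = (pascal_shift ^^ h) l i - l i" for i
    define B' where "B' = (S ^^ h) -` B \<inter> B"
    have B' [measurable]: "B' \<in> sets N"
      using measurable_sets[of "S ^^ h" N N B] Suc.prems(4) by (simp add: B'_def spaceN)
    have l': "\<And>i. i < Suc k \<Longrightarrow> l' i = 0" "l' (Suc k) = int h * l k"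
      using funpow_pascal_shift_leading[of k l h] Suc.prems(2) by (auto simp: l'_def less_Suc_eq)
    have "AE x in M. monomial l ((T ^^ h) x) * cnj (monomial l x) = monomial l' x"
      using monomial_funpow_T[of l h] by eventually_elim (simp add: monomial_diff l'_def[abs_def])
    then have "corr (\<lambda>x. monomial l ((T ^^ h) x) * cnj (monomial l x)) B' = corr (monomial l') B'"
      by (rule corr_cong_AE) auto
    moreover have "norm (corr (monomial l') B') \<le> \<bar>C\<bar> / real h"
    proof (cases "Suc k < d")
      case True
      have "corr (monomial l') B' = 0"
        by (rule Suc.hyps(1)[of "Suc k"]) (use Suc.hyps(2) True l' h Suc.prems(3) B' in auto)
      then show ?thesis by simp
    next
      \<comment> \<open>The exponent of \<open>D d\<close> is now \<open>h * l k\<close> with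
        \<open>l k\<close> non-zero, so its modulus is at least \<open>h\<close> and the decay gives
        \<open>\<bar>C\<bar> / h\<close>.\<close>
      case False
      then have d: "d = Suc k" using Suc.prems(1) by simp
      have l'_top: "l' i = 0" if "i < d" for i using l'(1) d that by simp
      have "l' d \<noteq> 0" using l'(2) d h Suc.prems(3) by simp
      have "norm (corr (monomial l') B') = norm (\<integral>x. D d x powi l' d \<partial>M) * measure N B'"
        using corr_monomial_top[OF l'_top B'] by (simp add: norm_mult monomial_top[OF l'_top])
      also have "\<dots> \<le> (C / \<bar>l' d\<bar>) * 1"
        by (rule mult_mono[OF decay[OF \<open>l' d \<noteq> 0\<close>]])
          (use order_trans[OF norm_ge_zero decay[OF \<open>l' d \<noteq> 0\<close>]] in auto)
      also have "\<dots> \<le> \<bar>C\<bar> / \<bar>l' d\<bar>" by (simp add: divide_right_mono)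
      also have "\<dots> \<le> \<bar>C\<bar> / real h"
      proof (rule divide_left_mono)
        have "1 \<le> \<bar>l k\<bar>" using Suc.prems(3) by linarith
        then have "int h * 1 \<le> int h * \<bar>l k\<bar>" by (intro mult_left_mono) auto
        then have "int h \<le> \<bar>l' d\<bar>" by (simp add: d l'(2) abs_mult)
        then show "real h \<le> real_of_int \<bar>l' d\<bar>" by linarith
      qed (use h \<open>l' d \<noteq> 0\<close> in auto)
      finally show ?thesis .
    qed
    ultimately show "norm (corr (\<lambda>x. monomial l ((T ^^ h) x) * cnj (monomial l x))
        ((S ^^ h) -` B \<inter> B)) \<le> \<bar>C\<bar> / real h"
      by (simp add: B'_def)
  qed (use Suc.prems(4) norm_monomial in auto)
qed

text \<open>If some exponent below \<open>d\<close> is non-zero, both sides vanish: the integral is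
  itself the correlation with the whole space.\<close>

lemma corr_monomial:
  assumes B: "B \<in> sets N"
  shows "corr (monomial l) B = (\<integral>x. monomial l x \<partial>M) * measure N B"
proof (cases "\<exists>i<d. l i \<noteq> 0")
  case True
  define k where "k = (LEAST i. l i \<noteq> 0)"
  have k: "k < d" "l k \<noteq> 0" "\<And>i. i < k \<Longrightarrow> l i = 0"
    using True LeastI_ex[of "\<lambda>i. l i \<noteq> 0"] unfolding k_def
    by (auto dest: not_less_Least intro!: le_less_trans[OF Least_le])
  have U: "UNIV \<in> sets N" using sets.top[of N] by (simp add: spaceN)
  have "corr (monomial l) B = 0" using k B by (intro corr_monomial_eq_0) auto
  moreover have "(\<integral>x. monomial l x \<partial>M) = 0"
    using corr_monomial_eq_0[of k l UNIV] k U by (simp add: corr_UNIV)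
  ultimately show ?thesis by simp
next
  case False
  then show ?thesis using B by (intro corr_monomial_top) auto
qed

text \<open>The algebra consists of continuous functions that agree with monomials almost
  everywhere; this is the kind of identity coordinate functions satisfy, as
  \<open>D (Suc d) = 1\<close> holds outside a null set.\<close>

lemma eq_pair_measure_if_monomials_separate:
  assumes sep: "\<And>x y. x \<noteq> y \<Longrightarrow>
    \<exists>F l. continuous_on UNIV F \<and> F x \<noteq> F y \<and> (AE x in M. F x = monomial l x)"
  shows "J = M \<Otimes>\<^sub>M N"
proof (rule eq_pair_measure_if_corr[where \<C> = "{F. continuous_on UNIV F \<and> (\<exists>l. AE x in M. F x = monomial l x)}"],
    goal_cases)
  case 2
  have "AE x in M. 1 = monomial (\<lambda>_. 0) x" by (simp add: monomial_def)
  then show ?case by (auto intro: exI[of _ "\<lambda>_. 0"])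
next
  case (3 F G)
  then obtain l l' where l: "AE x in M. F x = monomial l x" "AE x in M. G x = monomial l' x" by blast
  then have "AE x in M. F x * G x = monomial (\<lambda>i. l i + l' i) x"
    by eventually_elim (simp add: monomial_add)
  with 3 show ?case by (auto intro!: continuous_intros)
next
  case (4 F)
  then obtain l where "AE x in M. F x = monomial l x" by blast
  then have "AE x in M. cnj (F x) = monomial (\<lambda>i. 0 - l i) x"
  proof eventually_elim
    case (elim x)
    have "monomial (\<lambda>_. 0) x = 1" by (simp add: monomial_def)
    then show ?case using elim monomial_diff[of "\<lambda>_. 0" x l] by simp
  qed
  with 4 show ?case by (auto intro!: continuous_intros)
next
  case (6 F B)
  then obtain l where F: "continuous_on UNIV F" and l: "AE x in M. F x = monomial l x" by blast
  have [measurable]: "F \<in> borel_measurable M" using F by (rule borel_measurable_continuous)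
  have "corr F B = corr (monomial l) B" using l 6(2) by (intro corr_cong_AE) auto
  also have "\<dots> = (\<integral>x. monomial l x \<partial>M) * measure N B" by (rule corr_monomial) (rule 6(2))
  also have "(\<integral>x. monomial l x \<partial>M) = (\<integral>x. F x \<partial>M)"
    using l by (intro integral_cong_AE) (auto elim!: eventually_mono)
  finally show ?case .
next
  case (5 x y)
  from sep[OF this] show ?case by blast
qed auto

end

section \<open>Furstenberg systems of Hardy field sequences\<close>

text \<open>The multiplicative form of \<open>fdiff ^^ i\<close> at time 0, read through the map
  \<open>E\<close> to the complex numbers; it is a function on the whole shift space, not just on
  the orbit of the sequence.\<close>

primrec mult_diff :: "('y \<Rightarrow> complex) \<Rightarrow> nat \<Rightarrow> (int \<Rightarrow> 'y) \<Rightarrow> complex" where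
  "mult_diff E 0 x = E (x 0)"
| "mult_diff E (Suc i) x = mult_diff E i (left_shift x) / mult_diff E i x"

lemma funpow_left_shift: "(left_shift ^^ m) x = (\<lambda>n. x (n + int m))"
  by (induction m) (auto simp: left_shift_def algebra_simps)

lemma continuous_on_left_shift:
  "continuous_on UNIV (left_shift :: (int \<Rightarrow> 'y::topological_space) \<Rightarrow> _)"
  unfolding left_shift_def[abs_def]
  by (intro continuous_on_coordinatewise_then_product continuous_on_product_coordinates)

text \<open>Cesaro means, by comparing the partial sums with
  \<open>\<epsilon> / 4 * n\<close>.\<close>

lemma averages_tendsto_0:
  fixes u :: "nat \<Rightarrow> real"
  assumes "u \<longlonglongrightarrow> 0"
  shows "(\<lambda>n. (\<Sum>m=1..n. u m) / real n) \<longlonglongrightarrow> 0"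
  unfolding tendsto_iff
proof (intro allI impI)
  fix \<epsilon> :: real assume "\<epsilon> > 0"
  define v where "v n = \<epsilon> / 4 * real n" for n
  have "filterlim v at_top sequentially"
    unfolding v_def using \<open>\<epsilon> > 0\<close>
    by (intro filterlim_tendsto_pos_mult_at_top[OF tendsto_const] filterlim_real_sequentially) simp
  moreover have "(\<lambda>n. u (Suc n)) \<longlonglongrightarrow> 0" using assms by (rule LIMSEQ_Suc)
  then have "\<forall>\<^sub>F n in sequentially. \<bar>u (Suc n)\<bar> < \<epsilon> / 4"
    using \<open>\<epsilon> > 0\<close> unfolding tendsto_iff dist_real_def by (elim allE[of _ "\<epsilon> / 4"]) simp
  then have "\<forall>\<^sub>F n in sequentially. \<bar>(\<Sum>m=1..Suc n. u m) - (\<Sum>m=1..n. u m)\<bar> \<le> v (Suc n) - v n"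
    by eventually_elim (simp add: v_def algebra_simps)
  ultimately have "\<forall>\<^sub>F n in sequentially. \<bar>\<Sum>m=1..n. u m\<bar> \<le> 2 * v n"
    by (rule eventually_abs_le_of_increments[rotated])
  then show "\<forall>\<^sub>F n in sequentially. dist ((\<Sum>m=1..n. u m) / real n) 0 < \<epsilon>"
    using eventually_gt_at_top[of 0]
  proof eventually_elim
    case (elim n)
    have "\<bar>\<Sum>m=1..n. u m\<bar> \<le> \<epsilon> / 2 * real n" using elim(1) by (simp add: v_def)
    also have "\<dots> < \<epsilon> * real n" using elim(2) \<open>\<epsilon> > 0\<close> by simp
    finally show ?case using elim(2) by (simp add: pos_divide_less_eq)
  qed
qed

text \<open>Treats the torus and the unit circle together: injectivity lets coordinate functions
  separate points, and modulus 1 makes the quotients in \<open>mult_diff\<close> meaningful.\<close>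

locale circle_chart =
  fixes E :: "'y::compact_metric_space \<Rightarrow> complex"
  assumes E_cont: "continuous_on UNIV E" and E_inj: "inj E" and norm_E: "norm (E y) = 1"
begin

lemma continuous_on_E_coordinate: "continuous_on UNIV (\<lambda>x. E (x (n::int)))"
  by (rule continuous_on_compose2[OF E_cont continuous_on_product_coordinates]) auto

lemma norm_mult_diff: "norm (mult_diff E i x) = 1"
  by (induction i arbitrary: x) (simp_all add: norm_E norm_divide)

lemma mult_diff_nonzero: "mult_diff E i x \<noteq> 0"
  using norm_mult_diff[of i x] by auto

lemma continuous_on_mult_diff: "continuous_on UNIV (mult_diff E i)"
proof (induction i)
  case 0
  show ?case using continuous_on_E_coordinate[of 0] by simp
next
  case (Suc i)
  have "continuous_on UNIV (\<lambda>x. mult_diff E i (left_shift x))"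
    by (rule continuous_on_compose2[OF Suc continuous_on_left_shift]) auto
  with Suc show ?case
    by (auto intro!: continuous_intros simp: mult_diff_nonzero)
qed

text \<open>For \<open>m \<ge> 1\<close> only coordinates at positive times are involved, so the
  arbitrary extension of the sequence to the integers does not matter.\<close>

lemma mult_diff_orbit:
  assumes x: "\<And>n. n \<ge> 1 \<Longrightarrow> E (x (int n)) = e_real (a (real n))" and m: "m \<ge> 1"
  shows "mult_diff E i ((left_shift ^^ m) x) = e_real ((fdiff ^^ i) a (real m))"
  using m
proof (induction i arbitrary: m)
  case 0
  then show ?case using x[of m] by (simp add: funpow_left_shift)
next
  case (Suc i)
  have "mult_diff E (Suc i) ((left_shift ^^ m) x) =
      mult_diff E i ((left_shift ^^ Suc m) x) / mult_diff E i ((left_shift ^^ m) x)" by simp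
  also have "\<dots> = e_real ((fdiff ^^ i) a (real (Suc m))) / e_real ((fdiff ^^ i) a (real m))"
    using Suc.IH[of m] Suc.IH[of "Suc m"] Suc.prems by (simp del: funpow.simps)
  also have "\<dots> = e_real ((fdiff ^^ Suc i) a (real m))"
    by (simp only: e_real_diff funpow_fdiff_Suc_of_nat)
  finally show ?case .
qed

lemma furstenberg_system_on_complex:
  fixes F :: "(int \<Rightarrow> 'y) \<Rightarrow> complex"
  assumes "furstenberg_system_on x K M" and F: "continuous_on UNIV F"
  shows "(\<lambda>k. (\<Sum>m=1..K k. F ((left_shift ^^ m) x)) / of_nat (K k)) \<longlonglongrightarrow> (\<integral>x. F x \<partial>M)"
proof -
  have sets: "sets M = sets borel" and M: "prob_space M"
    and lim: "\<And>f :: (int \<Rightarrow> 'y) \<Rightarrow> real. continuous_on UNIV f \<Longrightarrow>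
        (\<lambda>k. (\<Sum>m=1..K k. f ((left_shift ^^ m) x)) / real (K k)) \<longlonglongrightarrow> integral\<^sup>L M f"
    using assms(1) by (auto simp: furstenberg_system_on_def)
  interpret prob_space M by fact
  obtain C where C: "\<And>x. norm (F x) \<le> C" using continuous_on_UNIV_bounded[OF F] by blast
  have [measurable]: "F \<in> borel_measurable M"
    using borel_measurable_continuous_onI[OF F] sets by (simp cong: measurable_cong_sets)
  have int: "integrable M F" using C by (intro integrable_const_bound[of _ C]) auto
  have "(\<lambda>k. (\<Sum>m=1..K k. Re (F ((left_shift ^^ m) x))) / real (K k)) \<longlonglongrightarrow> Re (\<integral>x. F x \<partial>M)"
    using lim[OF continuous_on_Re[OF F]] unfolding integral_Re[OF int] .
  moreover have "(\<lambda>k. (\<Sum>m=1..K k. Im (F ((left_shift ^^ m) x))) / real (K k)) \<longlonglongrightarrow> Im (\<integral>x. F x \<partial>M)"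
    using lim[OF continuous_on_Im[OF F]] unfolding integral_Im[OF int] .
  ultimately show ?thesis
    unfolding tendsto_complex_iff by (simp add: Re_divide_of_nat Im_divide_of_nat)
qed

lemma disjoint_furstenberg_system:
  fixes a :: "real \<Rightarrow> real" and N :: "'z::compact_metric_space measure"
  assumes H: "hardy_field H" "germ_of a \<in> H"
    and growth: "growth_less a (\<lambda>t. t ^ Suc d)"
      "\<forall>\<^sub>F t in at_top. c0 * (t ^ d * ln t) \<le> \<bar>a t\<bar>" "c0 > 0"
    and erg: "ergodic_system N S"
    and x: "\<And>n. n \<ge> 1 \<Longrightarrow> E (x (int n)) = e_real (a (real n))"
    and fs: "furstenberg_system_on x K M"
  shows "disjoint_systems M left_shift N S"
  unfolding disjoint_systems_def
proof (intro allI impI)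
  fix J assume J: "joining M left_shift N S J"
  have K: "strict_mono K" "\<And>k. K k > 0" and sets: "sets M = sets borel" and M: "prob_space M"
    using fs by (auto simp: furstenberg_system_on_def)
  have meas: "F \<in> borel_measurable M" if "continuous_on UNIV F" for F :: "_ \<Rightarrow> 'b::topological_space"
    using borel_measurable_continuous_onI[OF that] sets by (simp cong: measurable_cong_sets)
  obtain \<sigma> c t0 where \<sigma>: "\<sigma> = 1 \<or> \<sigma> = (-1::real)" and c: "c > 0"
    and ge: "\<And>t. t \<ge> t0 \<Longrightarrow> c \<le> t * (\<sigma> * (fdiff ^^ Suc d) a t)"
    and anti: "\<And>s t. t0 \<le> s \<Longrightarrow> s \<le> t \<Longrightarrow> \<sigma> * (fdiff ^^ Suc d) a t \<le> \<sigma> * (fdiff ^^ Suc d) a s"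
    using hardy_field_funpow_fdiff_asymp[OF H growth] by blast
  have orbit: "mult_diff E i ((left_shift ^^ m) x) = e_real ((fdiff ^^ i) a (real m))"
    if "m \<ge> 1" for i m
    using x that by (rule mult_diff_orbit)
  have lim: "(\<lambda>n. (fdiff ^^ Suc d) a (real n)) \<longlonglongrightarrow> 0"
    using filterlim_compose[OF funpow_fdiff_tendsto_0[OF H growth(1)] filterlim_real_sequentially] .
  \<comment> \<open>The averages of this continuous function along the orbit are exponential sums
    with phases \<open>h * (fdiff ^^ d) a n\<close>, and their limit is the integral.\<close>
  have decay: "norm (\<integral>x. mult_diff E d x powi h \<partial>M) \<le> ((2 + 2 * pi) / c) / \<bar>h\<bar>" if h: "h \<noteq> 0" for h :: int
  proof -
    have "continuous_on UNIV (\<lambda>x. mult_diff E d x powi h)"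
      by (intro continuous_intros continuous_on_mult_diff) (auto simp: mult_diff_nonzero)
    from furstenberg_system_on_complex[OF fs this]
    have z: "(\<lambda>k. (\<Sum>n=1..K k. e_real (real_of_int h * (fdiff ^^ d) a (real n))) / of_nat (K k))
        \<longlonglongrightarrow> (\<integral>x. mult_diff E d x powi h \<partial>M)"
      by (simp add: orbit e_real_power_int)
    have "norm (\<integral>x. mult_diff E d x powi h \<partial>M) \<le> (2 + 2 * pi) / (c * \<bar>real_of_int h\<bar>)"
    proof (rule e_real_average_limit_bound[OF _ c _ \<sigma> _ _ K z, of "nat \<lceil>t0\<rceil>"];
        (unfold funpow_fdiff_Suc_of_nat[symmetric])?)
      fix n :: nat assume "n \<ge> nat \<lceil>t0\<rceil>"
      then have n: "real n \<ge> t0" by linarith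
      show "c \<le> real n * (\<sigma> * (fdiff ^^ Suc d) a (real n))" using n by (rule ge)
      show "\<sigma> * (fdiff ^^ Suc d) a (real (Suc n)) \<le> \<sigma> * (fdiff ^^ Suc d) a (real n)"
        using n by (rule anti) simp
    qed (use lim h in auto)
    then show ?thesis by simp
  qed
  \<comment> \<open>Along the orbit this function is \<open>e_real\<close> of a sequence tending to
    0, so the averages of its distance from 1 tend to 0, and the integral of that distance is
    0.\<close>
  have top: "AE x in M. mult_diff E (Suc d) x = 1"
  proof -
    interpret prob_space M by fact
    let ?f = "\<lambda>x. norm (mult_diff E (Suc d) x - 1)"
    have cont: "continuous_on UNIV ?f"
      by (intro continuous_intros continuous_on_mult_diff)
    have [measurable]: "?f \<in> borel_measurable M" using cont by (rule meas)
    define u where "u n = norm (e_real ((fdiff ^^ Suc d) a (real n)) - 1)" for n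
    have "u \<longlonglongrightarrow> 0"
    proof -
      have "(\<lambda>n. norm (e_real ((fdiff ^^ Suc d) a (real n)) - 1)) \<longlonglongrightarrow> norm (1 - 1 :: complex)"
        by (intro tendsto_intros e_real_tendsto_1 lim)
      then show ?thesis by (simp add: u_def[abs_def])
    qed
    then have "(\<lambda>n. (\<Sum>m=1..n. u m) / real n) \<longlonglongrightarrow> 0"
      by (rule averages_tendsto_0)
    then have "(\<lambda>k. (\<Sum>m=1..K k. u m) / real (K k)) \<longlonglongrightarrow> 0"
      by (rule filterlim_compose[OF _ filterlim_subseq[OF K(1)]])
    moreover have "(\<lambda>k. (\<Sum>m=1..K k. ?f ((left_shift ^^ m) x)) / real (K k)) \<longlonglongrightarrow> integral\<^sup>L M ?f"
      using fs cont by (auto simp: furstenberg_system_on_def)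
    then have "(\<lambda>k. (\<Sum>m=1..K k. u m) / real (K k)) \<longlonglongrightarrow> integral\<^sup>L M ?f"
      by (simp add: orbit u_def del: funpow.simps mult_diff.simps)
    ultimately have "integral\<^sup>L M ?f = 0" by (rule LIMSEQ_unique[symmetric])
    moreover have "integrable M ?f"
    proof -
      obtain C where "\<And>x. norm (?f x) \<le> C" using continuous_on_UNIV_bounded[OF cont] by blast
      then show ?thesis
        by (intro integrable_const_bound[of _ C]) (auto simp del: mult_diff.simps)
    qed
    ultimately have "AE x in M. ?f x = 0"
      by (subst (asm) integral_nonneg_eq_0_iff_AE) auto
    then show ?thesis by eventually_elim simp
  qed
  have T: "left_shift \<in> M \<rightarrow>\<^sub>M M"
    using meas[OF continuous_on_left_shift] sets by (simp cong: measurable_cong_sets)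
  interpret unipotent_joining M left_shift N S J "mult_diff E" d "(2 + 2 * pi) / c"
  proof (intro unipotent_joining.intro unipotent_joining_axioms.intro ergodic_joining.intro)
    show "mult_diff E i \<in> borel_measurable M" for i by (intro meas continuous_on_mult_diff)
    show "mult_diff E i (left_shift x) = mult_diff E i x * mult_diff E (Suc i) x" for i x
      by (simp add: mult_diff_nonzero)
  qed (fact sets M T erg J top norm_mult_diff decay)+
  show "J = M \<Otimes>\<^sub>M N"
  proof (rule eq_pair_measure_if_monomials_separate)
    fix x y :: "int \<Rightarrow> 'y" assume "x \<noteq> y"
    then obtain n where n: "x n \<noteq> y n" by auto
    define F where "F x = E (x n)" for x :: "int \<Rightarrow> 'y"
    have F: "continuous_on UNIV F" unfolding F_def by (rule continuous_on_E_coordinate)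
    have [measurable]: "F \<in> borel_measurable M" using F by (rule meas)
    \<comment> \<open>The exponent vector of the coordinate at time 0; the other coordinates are
      translates of this one.\<close>
    define l0 where "l0 i = (if i = 0 then 1 else 0 :: int)" for i :: nat
    have l0: "monomial l0 x = E (x 0)" for x
    proof -
      have "monomial l0 x = (\<Prod>i\<in>{0}. mult_diff E i x powi l0 i)"
        unfolding monomial_def by (intro prod.mono_neutral_right) (auto simp: l0_def)
      then show ?thesis by (simp add: l0_def)
    qed
    have "\<exists>l. AE x in M. F x = monomial l x"
    proof (cases "n \<ge> 0")
      case True
      then have "F x = monomial l0 ((left_shift ^^ nat n) x)" for x
        by (simp add: l0 funpow_left_shift F_def)
      then show ?thesis using monomial_funpow_T[of l0 "nat n"] by auto
    next
      \<comment> \<open>For negative \<open>n\<close> it is a forward translate of \<open>F\<close>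
        that equals the coordinate at time 0, so the shift has to be undone.\<close>
      case False
      then have "F ((left_shift ^^ nat (- n)) x) = monomial l0 x" for x
        by (simp add: l0 funpow_left_shift F_def)
      then show ?thesis by (intro ex_monomial_if_funpow_T[of _ "nat (- n)" l0]) auto
    qed
    moreover have "F x \<noteq> F y" using n E_inj by (simp add: F_def inj_eq)
    ultimately show "\<exists>F l. continuous_on UNIV F \<and> F x \<noteq> F y \<and> (AE x in M. F x = monomial l x)"
      using F by blast
  qed
qed

end

section \<open>The two concrete charts, torus and unit circle\<close>

lift_definition torus_to_complex :: "torus \<Rightarrow> complex" is e_real
proof -
  fix s t :: real assume "s - t \<in> \<int>"
  then have "e_real (s - t) = 1" by (simp add: e_real_eq_1_iff)
  then show "e_real s = e_real t" by (simp add: e_real_diff)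
qed

lemma torus_to_complex_mod_one: "torus_to_complex (mod_one t) = e_real t"
  by transfer simp

interpretation torus: circle_chart torus_to_complex
proof
  show "norm (torus_to_complex y) = 1" for y by transfer simp
  show "inj torus_to_complex"
  proof (rule injI)
    fix x y show "torus_to_complex x = torus_to_complex y \<Longrightarrow> x = y"
    proof transfer
      fix s t assume "e_real s = e_real t"
      then have "e_real (s - t) = 1" by (simp add: e_real_diff)
      then show "s - t \<in> \<int>" by (simp add: e_real_eq_1_iff)
    qed
  qed
  have le: "dist (torus_to_complex x) (torus_to_complex y) \<le> 2 * pi * dist x y" for x y
  proof transfer
    fix s t :: real
    obtain k where k: "k \<in> \<int>" "infdist (s - t) \<int> = \<bar>s - t - k\<bar>" by (rule infdist_Ints_attained)
    \<comment> \<open>The nearest integer \<open>k\<close> realises the distance in the torus, and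
      adding it to \<open>t\<close> does not change \<open>e_real t\<close>.\<close>
    have "e_real (t + k) = e_real t" using k(1) by (simp add: e_real_add e_real_eq_1_iff[THEN iffD2])
    then show "dist (e_real s) (e_real t) \<le> 2 * pi * infdist (s - t) \<int>"
      using norm_e_real_diff_le[of s "t + k"] by (simp add: dist_norm k(2) algebra_simps)
  qed
  have "(2 * pi)-lipschitz_on UNIV torus_to_complex"
    by (rule lipschitz_onI) (use le in auto)
  then show "continuous_on UNIV torus_to_complex" by (rule lipschitz_on_continuous_on)
qed

interpretation unit_circle: circle_chart complex_of_circle
proof
  show "continuous_on UNIV complex_of_circle"
    unfolding continuous_on_iff dist_unit_circle.rep_eq by auto
  show "inj complex_of_circle" by (simp add: inj_def complex_of_circle_inject)
  show "norm (complex_of_circle y) = 1" for y using complex_of_circle[of y] by simp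
qed

lemma complex_of_circle_e_circle: "complex_of_circle (e_circle t) = e_real t"
  by (simp add: e_circle.rep_eq e_real_def cis_conv_exp mult_ac)

theorem corollary1p2:
  fixes a :: "real \<Rightarrow> real"
    and N :: "'z::compact_metric_space measure" and S :: "'z \<Rightarrow> 'z"
  assumes "hardy_field_function a"
    and "\<exists>d::nat. (growth_less (\<lambda>t. t ^ d * ln t) a \<and> growth_less a (\<lambda>t. t ^ (d + 1))) \<or>
           growth_equiv a (\<lambda>t. t ^ d * ln t)"
    and "ergodic_system N S"
  shows "(\<forall>M. furstenberg_system (\<lambda>n. mod_one (a (real n))) M \<longrightarrow> disjoint_systems M left_shift N S) \<and>
         (\<forall>M. furstenberg_system (\<lambda>n. e_circle (a (real n))) M \<longrightarrow> disjoint_systems M left_shift N S)"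
proof -
  obtain H where H: "hardy_field H" "germ_of a \<in> H"
    using assms(1) by (auto simp: hardy_field_function_def)
  obtain d where "(growth_less (\<lambda>t. t ^ d * ln t) a \<and> growth_less a (\<lambda>t. t ^ (d + 1))) \<or>
      growth_equiv a (\<lambda>t. t ^ d * ln t)" using assms(2) ..
  then obtain c0 where c0: "c0 > 0" "\<forall>\<^sub>F t in at_top. c0 * (t ^ d * ln t) \<le> \<bar>a t\<bar>"
    "growth_less a (\<lambda>t. t ^ Suc d)"
    by (rule growth_bounds)
  show ?thesis
  proof (intro conjI allI impI)
    fix M assume "furstenberg_system (\<lambda>n. mod_one (a (real n))) M"
    then obtain x K where "\<And>n. n \<ge> 1 \<Longrightarrow> x (int n) = mod_one (a (real n))" "furstenberg_system_on x K M"
      by (auto simp: furstenberg_system_def)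
    then show "disjoint_systems M left_shift N S"
      by (intro torus.disjoint_furstenberg_system[OF H c0(3,2,1) assms(3)])
        (auto simp: torus_to_complex_mod_one)
  next
    fix M assume "furstenberg_system (\<lambda>n. e_circle (a (real n))) M"
    then obtain x K where "\<And>n. n \<ge> 1 \<Longrightarrow> x (int n) = e_circle (a (real n))" "furstenberg_system_on x K M"
      by (auto simp: furstenberg_system_def)
    then show "disjoint_systems M left_shift N S"
      by (intro unit_circle.disjoint_furstenberg_system[OF H c0(3,2,1) assms(3)])
        (auto simp: complex_of_circle_e_circle)
  qed
qed

end
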